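(* Let $N\ge 3$. Let $1<p<r\le\infty$ be such that $$p>\frac{N}{N-2},\qquad r>\frac{N(p-1)}{2}.$$ Assume that $\mu$ is a nontrivial nonnegative Radon measure in ${\mathbb R}^N$ satisfying $$\Gamma*\mu\in L^r_{\rm loc}({\mathbb R}^N),\qquad \limsup_{R\to\infty}R^{-\frac{N}{r}-\theta}\|\Gamma*\mu\|_{L^r(A(0,R))}<\infty\quad\mbox{for some}\quad\theta<-\frac{2}{p-1}.$$ For $\kappa>0$ consider the problem $$(\mathrm{P}'_\kappa)\qquad -\Delta u=u^p+\kappa\mu\ \mbox{ in }{\mathbb R}^N,\qquad u>0\ \mbox{ in }{\mathbb R}^N,\qquad u(x)\to0\ \mbox{ as }|x|\to\infty.$$ Then there exists $\kappa^*>0$ (with $\kappa^*<\infty$) such that (1) if $0<\kappa<\kappa^*$, then problem $(\mathrm{P}'_\kappa)$ possesses a minimal solution $u^\kappa$; (2) if $\kappa>\kappa^*$, then problem $(\mathrm{P}'_\kappa)$ possesses no solutions. Furthermore, there exists $\kappa_*\in(0,\kappa^*]$ such that (3) if $0<\kappa<\kappa_*$, then $$u^\kappa\in L^r_{\rm loc}({\mathbb R}^N),\qquad \limsup_{R\to\infty}R^{-\frac{N}{r}-\theta_*}\|u^\kappa\|_{L^r(A(0,R))}<\infty,$$ where $\theta_*:=\max\{\theta,-N+2\}$.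
   Context: Let $B(0,R)=\{y\in{\mathbb R}^N:|y|<R\}$ and $A(0,R)=B(0,R)\setminus B(0,R/2)$ for $R>0$. $\Gamma(x)=\frac{1}{N(N-2)\omega_N}|x|^{-N+2}$, where $\omega_N$ is the volume of $B(0,1)$, and $(\Gamma*\mu)(x)=\int_{{\mathbb R}^N}\Gamma(x-y)\,d\mu(y)$. Solutions to $(\mathrm{P}'_\kappa)$ are understood as follows: a nonnegative, measurable function $u$ in ${\mathbb R}^N$, finite and positive almost everywhere, is a solution to $(\mathrm{P}'_\kappa)$ if $$u(x)=\int_{{\mathbb R}^N}\Gamma(x-y)u(y)^p\,dy+\kappa\int_{{\mathbb R}^N}\Gamma(x-y)\,d\mu(y)\quad\mbox{for a.a. }x\in{\mathbb R}^N.$$ A solution $u$ is a minimal solution if, for any solution $v$ to $(\mathrm{P}'_\kappa)$, $u(x)\le v(x)$ for a.a. $x\in{\mathbb R}^N$; a minimal solution is unique if it exists. *)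

theory Defs
  imports "HOL-Analysis.Analysis" "HOL-Probability.Essential_Supremum"
begin

text \<open>
  Euclidean space of dimension \<open>N\<close> is a type of class \<open>euclidean_space\<close> with \<open>N = DIM('a)\<close>.
  Nonnegative measurable functions, which may take the value \<open>\<infinity>\<close>, are \<open>ennreal\<close>-valued.
\<close>

text \<open>The power \<open>a\<^sup>q\<close> of \<open>a \<in> [0,\<infinity>]\<close>; it is only used with \<open>q > 0\<close>, where \<open>\<infinity>\<^sup>q = \<infinity>\<close> and \<open>0\<^sup>q = 0\<close>.\<close>

definition epow :: "ennreal \<Rightarrow> real \<Rightarrow> ennreal" where
  "epow a q = (if a = \<infinity> then \<infinity> else ennreal (enn2real a powr q))"

definition annulus :: "real \<Rightarrow> 'a::euclidean_space set" where
  "annulus R = ball 0 R - ball 0 (R / 2)"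

text \<open>
  The fundamental solution of \<open>-\<Delta>\<close> for \<open>N \<ge> 3\<close>, with its natural value \<open>\<infinity>\<close> at the origin
  (\<open>0 powr s = 0\<close> in the library, so the origin has to be treated separately).
\<close>

definition fund_sol :: "'a::euclidean_space \<Rightarrow> ennreal" where
  "fund_sol x =
    (if x = 0 then \<infinity>
     else ennreal (1 / (real DIM('a) * (real DIM('a) - 2) * measure lborel (ball (0::'a) 1))
                   * norm x powr (2 - real DIM('a))))"

definition potential :: "'a::euclidean_space measure \<Rightarrow> 'a \<Rightarrow> ennreal" where
  "potential \<mu> x = (\<integral>\<^sup>+ y. fund_sol (x - y) \<partial>\<mu>)"

text \<open>
  The regularity conditions are automatic for locally finite Borel measures on Euclidean space;
  they are listed so that the definition is the usual one.
\<close>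

definition radon_measure :: "'a::euclidean_space measure \<Rightarrow> bool" where
  "radon_measure \<mu> \<longleftrightarrow>
     sets \<mu> = sets borel \<and>
     (\<forall>K. compact K \<longrightarrow> emeasure \<mu> K < \<infinity>) \<and>
     (\<forall>B \<in> sets borel. emeasure \<mu> B = (INF U \<in> {U. open U \<and> B \<subseteq> U}. emeasure \<mu> U)) \<and>
     (\<forall>U. open U \<longrightarrow> emeasure \<mu> U = (SUP K \<in> {K. compact K \<and> K \<subseteq> U}. emeasure \<mu> K))"

definition Lr_norm :: "ereal \<Rightarrow> 'a::euclidean_space set \<Rightarrow> ('a \<Rightarrow> ennreal) \<Rightarrow> ennreal" where
  "Lr_norm r A f =
    (if r = \<infinity> then esssup (restrict_space lebesgue A) f
     else epow (\<integral>\<^sup>+ x \<in> A. epow (f x) (real_of_ereal r) \<partial>lebesgue) (1 / real_of_ereal r))"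

definition in_Lr_loc :: "ereal \<Rightarrow> ('a::euclidean_space \<Rightarrow> ennreal) \<Rightarrow> bool" where
  "in_Lr_loc r f \<longleftrightarrow>
     f \<in> borel_measurable lebesgue \<and> (\<forall>K. compact K \<longrightarrow> Lr_norm r K f < \<infinity>)"

text \<open>\<open>limsup\<^bsub>R \<rightarrow> \<infinity>\<^esub> R\<^bsup>- N/r - \<theta>\<^esup> \<parallel>f\<parallel>\<^bsub>L\<^sup>r(A(0,R))\<^esub> < \<infinity>\<close>; the division in \<open>ereal\<close> gives \<open>N/\<infinity> = 0\<close>.\<close>

definition annular_growth :: "ereal \<Rightarrow> real \<Rightarrow> ('a::euclidean_space \<Rightarrow> ennreal) \<Rightarrow> bool" where
  "annular_growth r \<theta> f \<longleftrightarrow>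
     Limsup at_top
       (\<lambda>R::real. ennreal (R powr (- real_of_ereal (ereal (real DIM('a)) / r) - \<theta>))
                  * Lr_norm r (annulus R) f) < \<infinity>"

definition is_solution ::
    "real \<Rightarrow> 'a::euclidean_space measure \<Rightarrow> real \<Rightarrow> ('a \<Rightarrow> ennreal) \<Rightarrow> bool" where
  "is_solution p \<mu> \<kappa> u \<longleftrightarrow>
     u \<in> borel_measurable lebesgue \<and>
     (AE x in lebesgue. 0 < u x \<and> u x < \<infinity>) \<and>
     (AE x in lebesgue.
        u x = (\<integral>\<^sup>+ y. fund_sol (x - y) * epow (u y) p \<partial>lebesgue) + ennreal \<kappa> * potential \<mu> x)"

definition is_minimal_solution ::
    "real \<Rightarrow> 'a::euclidean_space measure \<Rightarrow> real \<Rightarrow> ('a \<Rightarrow> ennreal) \<Rightarrow> bool" where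
  "is_minimal_solution p \<mu> \<kappa> u \<longleftrightarrow>
     is_solution p \<mu> \<kappa> u \<and>
     (\<forall>v. is_solution p \<mu> \<kappa> v \<longrightarrow> (AE x in lebesgue. u x \<le> v x))"

end

(*
  The map u |-> Gamma * u^p + kappa Gamma * mu is monotone and commutes with increasing limits, so
  its iterates from 0 increase to the minimal solution as soon as their limit is finite almost
  everywhere; this happens below any supersolution, hence the set of admissible kappa is an interval.
  It is bounded because u >= Gamma * u^p on the unit ball bootstraps a large lower bound to infinity.

  For small kappa the iterates are bounded in the dyadic norm M with
  ||u||_{L^r(R <= max(1,|x|) < 2R)} <= M R^(N/r + theta) for all R >= 1, at the exponent
  theta = theta_*, because u |-> Gamma * u^p maps a bound M to C M^p. The part of the integral with
  |x - y| < max(1,|x|)/2 is handled by Young's inequality with the truncated kernel, which lies in L^q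
  for 1/q = 1 - (p-1)/r exactly because r > N(p-1)/2. In the remaining part
  Gamma(x - y) <= C max(1,|x|)^theta max(1,|y|)^(2-N-theta), and the y-integral converges because
  theta < -2/(p-1).
*)

theory Submission
  imports Defs
begin

section \<open>Powers in the extended half-line and integral inequalities\<close>

text \<open>The exponent \<theta>_* is dictated by the kernel: for nontrivial u the term \<Gamma> *
  u^p decays no faster than |x|^(2-N), so no bound with an exponent below 2-N survives the
  iteration, and \<theta> has to be raised to at least 2-N. The condition p > N/(N-2) says exactly
  that 2-N < -2/(p-1), so the raised exponent still satisfies 2 + (p-1) \<theta>_* < 0. This one
  sign acts twice: as the decay rate of a dyadic sum in the far part, and as a negative surplus
  power of R in the near part.

  The kernel must be split because \<Gamma> lies in no L^q on the whole space: the origin asks for q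
  < N/(N-2), infinity for q > N/(N-2). Truncation at distance comparable to max(1,|x|) restores
  Young's inequality at the price of a power of R, and by scaling that power fits the norm.

  Since p > 1, the bound C M^p is a small fraction of M once M is small. A small multiple of
  \<Gamma> * \<mu> then still fits, so M bounds all iterates and, by monotone convergence, their
  limit. Every minimal solution is dominated almost everywhere by this limit and inherits its
  bounds.\<close>

lemma epow_0 [simp]: "epow 0 q = 0"
  by (simp add: epow_def)

lemma epow_top [simp]: "epow top q = top"
  by (simp add: epow_def)

lemma epow_ennreal [simp]: "0 \<le> a \<Longrightarrow> epow (ennreal a) q = ennreal (a powr q)"
  by (simp add: epow_def)

lemma epow_one [simp]: "epow a 1 = a"
  by (cases a) auto

lemma epow_1 [simp]: "epow 1 q = 1"
  using epow_ennreal[of 1 q] by simp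

lemma epow_eq_0_iff [simp]: "epow a q = 0 \<longleftrightarrow> a = 0"
  by (cases a) auto

lemma epow_eq_top_iff [simp]: "epow a q = top \<longleftrightarrow> a = top"
  by (cases a) auto

lemma epow_mono: "a \<le> b \<Longrightarrow> 0 \<le> q \<Longrightarrow> epow a q \<le> epow b q"
  by (cases a; cases b) (auto intro!: ennreal_leI powr_mono2 simp: top_unique)

lemma epow_epow: "epow (epow a q) s = epow a (q * s)"
  by (cases a) (auto simp: powr_powr)

lemma epow_inverse [simp]: "q \<noteq> 0 \<Longrightarrow> epow (epow a q) (1 / q) = a" "q \<noteq> 0 \<Longrightarrow> epow (epow a (1 / q)) q = a"
  by (simp_all add: epow_epow)

lemma epow_mult: "epow (a * b) q = epow a q * epow b q"
proof (cases "a = top \<or> b = top")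
  case True
  then show ?thesis
    by (auto simp: ennreal_mult_eq_top_iff ennreal_top_mult ennreal_mult_top)
next
  case False
  then show ?thesis
    by (cases a; cases b) (auto simp: ennreal_mult[symmetric] powr_mult)
qed

text \<open>Exponents may have any sign because the conventions \<open>epow 0 q = 0\<close> and
  \<open>epow top q = top\<close> hold for every \<open>q\<close>.\<close>

lemma epow_add: "epow a (q + s) = epow a q * epow a s"
  by (cases a) (auto simp: ennreal_mult[symmetric] powr_add)

lemma epow_le_iff: "0 < q \<Longrightarrow> epow a q \<le> b \<longleftrightarrow> a \<le> epow b (1 / q)"
  using epow_mono[of a "epow b (1 / q)" q] epow_mono[of "epow a q" b "1 / q"] by auto

lemma epow_SUP:
  assumes "0 < q"
  shows "epow (SUP i\<in>I. f i) q = (SUP i\<in>I. epow (f i) q)"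
proof (rule antisym)
  show "epow (SUP i\<in>I. f i) q \<le> (SUP i\<in>I. epow (f i) q)"
    by (simp add: epow_le_iff[OF assms] SUP_le_iff) (auto simp: epow_le_iff[OF assms, symmetric] intro: SUP_upper)
  show "(SUP i\<in>I. epow (f i) q) \<le> epow (SUP i\<in>I. f i) q"
    using assms by (auto intro!: SUP_least epow_mono SUP_upper)
qed

lemma measurable_epow [measurable (raw)]:
  assumes [measurable]: "f \<in> borel_measurable M"
  shows "(\<lambda>x. epow (f x) q) \<in> borel_measurable M"
  unfolding epow_def by measurable

text \<open>Comparing with the maximum instead of using convexity covers exponents below 1 as well;
  both \<open>s\<close> and \<open>1 / s\<close> occur later.\<close>

lemma epow_add_le:
  assumes "0 \<le> q"
  shows "epow (a + b) q \<le> ennreal (2 powr q) * (epow a q + epow b q)"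
proof -
  have "a + b \<le> 2 * max a b"
    by (simp add: mult_2 add_mono)
  then have "epow (a + b) q \<le> epow 2 q * epow (max a b) q"
    using assms by (metis epow_mono epow_mult)
  also have "epow (max a b) q \<le> epow a q + epow b q"
    by (cases "a \<le> b") (auto simp: max_def)
  also have "epow 2 q = ennreal (2 powr q)"
    using epow_ennreal[of 2 q] by simp
  finally show ?thesis by (simp add: mult_left_mono)
qed

section \<open>Young's pointwise inequality and Hoelder's inequality for extended powers\<close>

lemma epow_Youngs_inequality:
  assumes "0 < s" "0 < t" "s + t = 1"
  shows "epow a s * epow b t \<le> ennreal s * a + ennreal t * b"
proof (cases "a = 0 \<or> b = 0 \<or> a = top \<or> b = top")
  case True
  then show ?thesis
    using assms by (auto simp: ennreal_mult_eq_top_iff ennreal_mult_top)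
next
  case False
  then obtain x y where "a = ennreal x" "b = ennreal y" "0 < x" "0 < y"
    by (cases a; cases b) auto
  then show ?thesis
    using assms Youngs_inequality_0[of s t x y]
    by (simp add: ennreal_mult[symmetric] ennreal_plus[symmetric] del: ennreal_plus)
qed

text \<open>After both functions are scaled to integral 1, the pointwise Young inequality integrates
  to \<open>s + t = 1\<close>. The degenerate cases are separate: a vanishing integral makes the
  product vanish almost everywhere, and an infinite one beside a nonzero one makes the right-hand
  side infinite.\<close>

lemma Holder_nn_integral:
  fixes f g :: "'b \<Rightarrow> ennreal"
  assumes [measurable]: "f \<in> borel_measurable M" "g \<in> borel_measurable M"
    and st: "0 < s" "0 < t" "s + t = 1"
  shows "(\<integral>\<^sup>+x. epow (f x) s * epow (g x) t \<partial>M) \<le> epow (integral\<^sup>N M f) s * epow (integral\<^sup>N M g) t"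
proof -
  consider "integral\<^sup>N M f = 0 \<or> integral\<^sup>N M g = 0"
    | "integral\<^sup>N M f \<noteq> 0" "integral\<^sup>N M g \<noteq> 0" "integral\<^sup>N M f = top \<or> integral\<^sup>N M g = top"
    | A B where "integral\<^sup>N M f = ennreal A" "integral\<^sup>N M g = ennreal B" "0 < A" "0 < B"
    by (cases "integral\<^sup>N M f"; cases "integral\<^sup>N M g") force+
  then show ?thesis
  proof cases
    case 1
    then have "AE x in M. epow (f x) s * epow (g x) t = 0"
      by (auto simp: nn_integral_0_iff_AE)
    then have "(\<integral>\<^sup>+x. epow (f x) s * epow (g x) t \<partial>M) = 0"
      by (subst nn_integral_0_iff_AE) auto
    then show ?thesis by simp
  next
    case 2
    then show ?thesis by (auto simp: ennreal_mult_eq_top_iff ennreal_top_mult ennreal_mult_top)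
  next
    case 3
    define c where "c = ennreal (A powr s * B powr t)"
    have "epow (f x) s * epow (g x) t
        = c * (epow (ennreal (1 / A) * f x) s * epow (ennreal (1 / B) * g x) t)" for x
    proof -
      have "c * (epow (ennreal (1 / A) * f x) s * epow (ennreal (1 / B) * g x) t)
          = (ennreal (A powr s * B powr t) * (epow (ennreal (1 / A)) s * epow (ennreal (1 / B)) t))
             * (epow (f x) s * epow (g x) t)"
        by (simp add: epow_mult c_def mult_ac)
      also have "ennreal (A powr s * B powr t) * (epow (ennreal (1 / A)) s * epow (ennreal (1 / B)) t) = 1"
        using 3 by (simp add: ennreal_mult[symmetric] powr_divide)
      finally show ?thesis by simp
    qed
    then have "(\<integral>\<^sup>+x. epow (f x) s * epow (g x) t \<partial>M)
       = c * (\<integral>\<^sup>+x. (epow (ennreal (1 / A) * f x) s * epow (ennreal (1 / B) * g x) t) \<partial>M)"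
      by (simp add: nn_integral_cmult)
    also have "\<dots> \<le> c * (\<integral>\<^sup>+x. ennreal s * (ennreal (1 / A) * f x) + ennreal t * (ennreal (1 / B) * g x) \<partial>M)"
      by (intro mult_left_mono nn_integral_mono epow_Youngs_inequality st) auto
    also have "(\<integral>\<^sup>+x. ennreal s * (ennreal (1 / A) * f x) + ennreal t * (ennreal (1 / B) * g x) \<partial>M)
       = ennreal s * (ennreal (1 / A) * ennreal A) + ennreal t * (ennreal (1 / B) * ennreal B)"
      using 3 by (simp add: nn_integral_add nn_integral_cmult)
    also have "\<dots> = 1"
      using 3 st by (simp add: ennreal_mult[symmetric] ennreal_plus[symmetric] del: ennreal_plus)
    finally show ?thesis
      using 3 by (simp add: c_def ennreal_mult)
  qed
qed

text \<open>The first two functions are merged into one, \<open>F\<close>, with exponents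
  renormalised by \<open>a + b\<close>; the two-function inequality is then applied once inside
  \<open>F\<close> and once to \<open>F\<close> and \<open>h\<close>.\<close>

lemma Holder_nn_integral3:
  fixes f g h :: "'b \<Rightarrow> ennreal"
  assumes [measurable]: "f \<in> borel_measurable M" "g \<in> borel_measurable M" "h \<in> borel_measurable M"
    and st: "0 < a" "0 < b" "0 < c" "a + b + c = 1"
  shows "(\<integral>\<^sup>+x. epow (f x) a * epow (g x) b * epow (h x) c \<partial>M)
     \<le> epow (integral\<^sup>N M f) a * epow (integral\<^sup>N M g) b * epow (integral\<^sup>N M h) c"
proof -
  define F where "F x = epow (f x) (a / (a + b)) * epow (g x) (b / (a + b))" for x
  have [measurable]: "F \<in> borel_measurable M" by (simp add: F_def[abs_def])
  have F: "epow (F x) (a + b) = epow (f x) a * epow (g x) b" for x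
    using st by (simp add: F_def epow_mult epow_epow)
  have "a / (a + b) + b / (a + b) = 1"
    using st by (simp add: add_divide_distrib[symmetric])
  then have "integral\<^sup>N M F \<le> epow (integral\<^sup>N M f) (a / (a + b)) * epow (integral\<^sup>N M g) (b / (a + b))"
    unfolding F_def[abs_def] using st by (intro Holder_nn_integral) auto
  then have "epow (integral\<^sup>N M F) (a + b) \<le> epow (integral\<^sup>N M f) a * epow (integral\<^sup>N M g) b"
    using epow_mono[of "integral\<^sup>N M F" "epow (integral\<^sup>N M f) (a / (a + b)) * epow (integral\<^sup>N M g) (b / (a + b))" "a + b"] st
    by (simp add: epow_mult epow_epow)
  moreover have "(\<integral>\<^sup>+x. epow (F x) (a + b) * epow (h x) c \<partial>M)
      \<le> epow (integral\<^sup>N M F) (a + b) * epow (integral\<^sup>N M h) c"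
    using st by (intro Holder_nn_integral) auto
  ultimately show ?thesis
    by (simp add: F) (meson mult_right_mono order_trans zero_le)
qed

section \<open>Convolutions and Young's convolution inequality\<close>

lemma nn_integral_lborel_reflect:
  fixes f :: "'a::euclidean_space \<Rightarrow> ennreal"
  assumes [measurable]: "f \<in> borel_measurable borel"
  shows "(\<integral>\<^sup>+y. f (x - y) \<partial>lborel) = integral\<^sup>N lborel f"
proof -
  have "lborel = distr lborel borel (\<lambda>y. x - y)"
    using lborel_affine[of "-1" x] by (simp add: density_1)
  then have "integral\<^sup>N lborel f = integral\<^sup>N (distr lborel borel (\<lambda>y. x - y)) f"
    by simp
  also have "\<dots> = (\<integral>\<^sup>+y. f (x - y) \<partial>lborel)"
    by (subst nn_integral_distr) auto
  finally show ?thesis by simp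
qed

lemma nn_integral_lborel_translate:
  fixes f :: "'a::euclidean_space \<Rightarrow> ennreal"
  assumes [measurable]: "f \<in> borel_measurable borel"
  shows "(\<integral>\<^sup>+x. f (x - y) \<partial>lborel) = integral\<^sup>N lborel f"
proof -
  have "integral\<^sup>N lborel f = integral\<^sup>N (distr lborel borel ((+) (- y))) f"
    by (simp add: lborel_distr_plus)
  also have "\<dots> = (\<integral>\<^sup>+x. f (x - y) \<partial>lborel)"
    by (subst nn_integral_distr) auto
  finally show ?thesis by simp
qed

lemma nn_integral_convolution:
  fixes f g :: "'a::euclidean_space \<Rightarrow> ennreal"
  assumes [measurable]: "f \<in> borel_measurable borel" "g \<in> borel_measurable borel"
  shows "(\<integral>\<^sup>+x. \<integral>\<^sup>+y. f (x - y) * g y \<partial>lborel \<partial>lborel) = integral\<^sup>N lborel f * integral\<^sup>N lborel g"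
proof -
  have "(\<integral>\<^sup>+x. \<integral>\<^sup>+y. f (x - y) * g y \<partial>lborel \<partial>lborel) = (\<integral>\<^sup>+y. \<integral>\<^sup>+x. f (x - y) * g y \<partial>lborel \<partial>lborel)"
    by (rule lborel_pair.Fubini'[symmetric]) measurable
  also have "\<dots> = (\<integral>\<^sup>+y. integral\<^sup>N lborel f * g y \<partial>lborel)"
    by (intro nn_integral_cong) (simp add: nn_integral_multc nn_integral_lborel_translate)
  finally show ?thesis by (simp add: nn_integral_cmult)
qed

text \<open>Young's convolution inequality, proved by distributing
  \<open>k g\<^sup>p = (k\<^sup>q)\<^sup>a (g\<^sup>r)\<^sup>b (k\<^sup>q g\<^sup>r)\<^sup>1\<^sup>/\<^sup>r\<close> with \<open>a = 1 - p/r\<close> and \<open>b = (p-1)/r\<close>.\<close>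

lemma Young_convolution_epow:
  fixes k g :: "'a::euclidean_space \<Rightarrow> ennreal"
  assumes [measurable]: "k \<in> borel_measurable borel" "g \<in> borel_measurable borel"
    and pr: "1 < p" "p < r" and q: "q = r / (r - p + 1)"
  shows "(\<integral>\<^sup>+x. epow (\<integral>\<^sup>+y. k (x - y) * epow (g y) p \<partial>lborel) r \<partial>lborel)
    \<le> epow (\<integral>\<^sup>+x. epow (k x) q \<partial>lborel) (r / q) * epow (\<integral>\<^sup>+x. epow (g x) r \<partial>lborel) p"
proof -
  define K where "K = (\<integral>\<^sup>+x. epow (k x) q \<partial>lborel)"
  define G where "G = (\<integral>\<^sup>+x. epow (g x) r \<partial>lborel)"
  define H where "H x = (\<integral>\<^sup>+y. epow (k (x - y)) q * epow (g y) r \<partial>lborel)" for x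
  define a b c where "a = 1 - p / r" and "b = (p - 1) / r" and "c = 1 / r"
  have abc: "0 < a" "0 < b" "0 < c" "a + b + c = 1"
    using pr by (auto simp: a_def b_def c_def field_simps)
  have ac: "a + c = (r - p + 1) / r" and rq: "r / q = r - p + 1"
    using pr by (auto simp: a_def c_def q field_simps)
  have "q * a + q * c = q * (a + c)" by (simp add: distrib_left)
  also have "\<dots> = 1" using pr by (simp add: ac q)
  finally have ex1: "q * a + q * c = 1" .
  have ex: "q * a + q * c = 1" "r * b + r * c = p" "a * r + 1 = r / q" "b * r + 1 = p" "c * r = 1"
    unfolding ex1 rq using pr by (simp_all add: a_def b_def c_def distrib_left[symmetric] field_simps)
  have split: "k (x - y) * epow (g y) p
      = epow (epow (k (x - y)) q) a * epow (epow (g y) r) b * epow (epow (k (x - y)) q * epow (g y) r) c" for x y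
  proof -
    have "epow (epow (k (x - y)) q) a * epow (epow (g y) r) b * epow (epow (k (x - y)) q * epow (g y) r) c
        = epow (k (x - y)) (q * a + q * c) * epow (g y) (r * b + r * c)"
      by (simp only: epow_mult epow_epow epow_add mult_ac)
    then show ?thesis by (simp only: ex epow_one)
  qed
  \<comment> \<open>Since \<open>c * r = 1\<close>, raising the Hoelder estimate to the power
    \<open>r\<close> leaves the mixed factor \<open>H\<close> linear, and its integral in
    \<open>x\<close> is a plain convolution. The other two factors do not depend on
    \<open>x\<close>.\<close>
  have "epow (\<integral>\<^sup>+y. k (x - y) * epow (g y) p \<partial>lborel) r \<le> epow K (a * r) * epow G (b * r) * H x" for x
  proof -
    have "(\<integral>\<^sup>+y. k (x - y) * epow (g y) p \<partial>lborel)
        \<le> epow (\<integral>\<^sup>+y. epow (k (x - y)) q \<partial>lborel) a * epow G b * epow (H x) c"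
      unfolding split G_def H_def by (rule Holder_nn_integral3) (use abc in \<open>auto\<close>)
    also have "(\<integral>\<^sup>+y. epow (k (x - y)) q \<partial>lborel) = K"
      unfolding K_def by (rule nn_integral_lborel_reflect) simp
    finally have "epow (\<integral>\<^sup>+y. k (x - y) * epow (g y) p \<partial>lborel) r
        \<le> epow (epow K a * epow G b * epow (H x) c) r"
      using pr by (intro epow_mono) auto
    also have "\<dots> = epow K (a * r) * epow G (b * r) * H x"
      by (simp add: epow_mult epow_epow ex)
    finally show ?thesis .
  qed
  then have "(\<integral>\<^sup>+x. epow (\<integral>\<^sup>+y. k (x - y) * epow (g y) p \<partial>lborel) r \<partial>lborel)
     \<le> (\<integral>\<^sup>+x. epow K (a * r) * epow G (b * r) * H x \<partial>lborel)"
    by (intro nn_integral_mono) auto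
  also have "\<dots> = epow K (a * r) * epow G (b * r) * (\<integral>\<^sup>+x. H x \<partial>lborel)"
    unfolding H_def by (rule nn_integral_cmult) measurable
  also have "(\<integral>\<^sup>+x. H x \<partial>lborel) = K * G"
    unfolding H_def K_def G_def by (rule nn_integral_convolution) auto
  also have "epow K (a * r) * epow G (b * r) * (K * G) = epow K (a * r + 1) * epow G (b * r + 1)"
    by (simp add: epow_add mult_ac)
  finally show ?thesis by (simp add: ex K_def G_def)
qed

section \<open>Lebesgue norms on subsets\<close>

text \<open>The real number 1/r with 1/\<infinity> = 0, so that one formula for the exponents serves
  finite and infinite \<open>r\<close>.\<close>

definition recip :: "ereal \<Rightarrow> real" where
  "recip r = (if r = \<infinity> then 0 else 1 / real_of_ereal r)"

lemma recip_simps [simp]: "recip \<infinity> = 0" "recip (ereal s) = 1 / s"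
  by (simp_all add: recip_def)

lemma exponent_cases [case_names infinite finite]:
  fixes r :: ereal
  assumes "1 < r"
  obtains "r = \<infinity>" | s where "r = ereal s" "1 < s"
  using assms by (cases r) (auto simp: one_ereal_def)

lemma real_of_ereal_divide_eq_recip: "1 < r \<Longrightarrow> real_of_ereal (ereal d / r) = d * recip r"
  by (cases rule: exponent_cases[of r]) auto

lemma Lr_norm_infinity_le_iff:
  assumes "f \<in> borel_measurable lebesgue" "A \<in> sets lebesgue"
  shows "Lr_norm \<infinity> A f \<le> c \<longleftrightarrow> (AE x in lebesgue. x \<in> A \<longrightarrow> f x \<le> c)"
proof -
  have f: "f \<in> borel_measurable (restrict_space lebesgue A)"
    using assms by (simp add: measurable_restrict_space1)
  have "esssup (restrict_space lebesgue A) f \<le> c \<longleftrightarrow> (AE x in restrict_space lebesgue A. f x \<le> c)"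
    using esssup_I[OF f] esssup_AE[where f=f and M="restrict_space lebesgue A"]
    by (auto elim!: eventually_mono intro: order_trans)
  then show ?thesis
    using assms by (simp add: Lr_norm_def AE_restrict_space_iff)
qed

lemma Lr_norm_ereal_le_iff:
  assumes "0 < s"
  shows "Lr_norm (ereal s) A f \<le> c \<longleftrightarrow> (\<integral>\<^sup>+x\<in>A. epow (f x) s \<partial>lebesgue) \<le> epow c s"
  using assms by (simp add: Lr_norm_def epow_le_iff)

lemma epow_Lr_norm_ereal:
  assumes "0 < s"
  shows "epow (Lr_norm (ereal s) A f) s = (\<integral>\<^sup>+x\<in>A. epow (f x) s \<partial>lebesgue)"
  using assms by (simp add: Lr_norm_def)

lemma Lr_norm_mono_AE:
  assumes r: "1 < r"
    and "f \<in> borel_measurable lebesgue" "g \<in> borel_measurable lebesgue" "A \<in> sets lebesgue" "B \<in> sets lebesgue"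
    and AB: "A \<subseteq> B" and fg: "AE x in lebesgue. x \<in> A \<longrightarrow> f x \<le> g x"
  shows "Lr_norm r A f \<le> Lr_norm r B g"
  using r
proof (cases rule: exponent_cases)
  case infinite
  have "AE x in lebesgue. x \<in> B \<longrightarrow> g x \<le> Lr_norm r B g"
    using assms Lr_norm_infinity_le_iff[of g B "Lr_norm r B g"] by (simp add: infinite)
  with fg have "AE x in lebesgue. x \<in> A \<longrightarrow> f x \<le> Lr_norm r B g"
    by eventually_elim (use AB in \<open>auto intro: order_trans\<close>)
  then show ?thesis
    using assms Lr_norm_infinity_le_iff[of f A] by (simp add: infinite)
next
  case (finite s)
  have "(\<integral>\<^sup>+x\<in>A. epow (f x) s \<partial>lebesgue) \<le> (\<integral>\<^sup>+x\<in>B. epow (g x) s \<partial>lebesgue)"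
    using fg finite AB by (intro nn_integral_mono_AE) (auto elim!: eventually_mono intro!: epow_mono split: split_indicator)
  then show ?thesis
    using finite by (simp add: Lr_norm_ereal_le_iff epow_Lr_norm_ereal)
qed

lemma Lr_norm_AE_le:
  assumes "f \<in> borel_measurable lebesgue" "A \<in> sets lebesgue"
  shows "AE x in lebesgue. x \<in> A \<longrightarrow> f x \<le> Lr_norm \<infinity> A f"
  using assms Lr_norm_infinity_le_iff by blast

lemma two_powr_le: "1 < s \<Longrightarrow> ennreal (2 powr (1 / s)) \<le> 2"
proof -
  assume "1 < s"
  then have "2 powr (1 / s) \<le> 2 powr 1" by (intro powr_mono) auto
  then have "ennreal (2 powr (1 / s)) \<le> ennreal 2" by (intro ennreal_leI) simp
  then show ?thesis by simp
qed

text \<open>The factor 2 is crude but independent of \<open>s\<close>, which gives the norm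
  inequalities below the same constants for all \<open>r\<close>, including \<infinity>.\<close>

lemma epow_add_powers_le:
  assumes "1 < s"
  shows "epow a s + epow b s \<le> epow (2 * (a + b)) s"
proof -
  have "epow (epow a s + epow b s) (1 / s) \<le> ennreal (2 powr (1 / s)) * (a + b)"
    using epow_add_le[of "1 / s" "epow a s" "epow b s"] assms by simp
  also have "\<dots> \<le> 2 * (a + b)"
    using assms by (intro mult_right_mono two_powr_le) auto
  finally show ?thesis
    using assms epow_le_iff[of "1 / s"] by simp
qed

lemma one_less_exponent: "1 < p \<Longrightarrow> ereal p < r \<Longrightarrow> 1 < r"
  by (cases r) (auto simp: one_ereal_def)

lemma Lr_norm_Un:
  assumes r: "1 < r"
    and [measurable]: "f \<in> borel_measurable lebesgue" "A \<in> sets lebesgue" "B \<in> sets lebesgue"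
  shows "Lr_norm r (A \<union> B) f \<le> 2 * (Lr_norm r A f + Lr_norm r B f)"
  using r
proof (cases rule: exponent_cases)
  case infinite
  have "Lr_norm r A f \<le> 2 * (Lr_norm r A f + Lr_norm r B f)" "Lr_norm r B f \<le> 2 * (Lr_norm r A f + Lr_norm r B f)"
    by (auto simp: mult_2 add_increasing add_increasing2)
  moreover have "AE x in lebesgue. x \<in> A \<longrightarrow> f x \<le> Lr_norm r A f" "AE x in lebesgue. x \<in> B \<longrightarrow> f x \<le> Lr_norm r B f"
    unfolding infinite by (rule Lr_norm_AE_le; simp)+
  ultimately have "AE x in lebesgue. x \<in> A \<union> B \<longrightarrow> f x \<le> 2 * (Lr_norm r A f + Lr_norm r B f)"
    by (auto elim!: eventually_elim2 intro: order_trans)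
  then show ?thesis
    unfolding infinite by (subst Lr_norm_infinity_le_iff) auto
next
  case (finite s)
  have "(\<integral>\<^sup>+x\<in>A \<union> B. epow (f x) s \<partial>lebesgue)
      \<le> (\<integral>\<^sup>+x. epow (f x) s * indicator A x + epow (f x) s * indicator B x \<partial>lebesgue)"
    by (intro nn_integral_mono) (auto split: split_indicator)
  also have "\<dots> = epow (Lr_norm r A f) s + epow (Lr_norm r B f) s"
    using finite by (simp add: nn_integral_add epow_Lr_norm_ereal)
  also have "\<dots> \<le> epow (2 * (Lr_norm r A f + Lr_norm r B f)) s"
    using finite by (simp only: epow_add_powers_le)
  finally show ?thesis
    using finite by (simp add: Lr_norm_ereal_le_iff)
qed

text \<open>A quasi-triangle inequality: one factor 2 comes from the power of a sum, the other from
  the sum of powers. An absolute constant is harmless because the smallness of the bound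
  \<open>M\<close> is fixed only at the end.\<close>

lemma Lr_norm_add:
  assumes r: "1 < r"
    and [measurable]: "f \<in> borel_measurable lebesgue" "g \<in> borel_measurable lebesgue" "A \<in> sets lebesgue"
  shows "Lr_norm r A (\<lambda>x. f x + g x) \<le> 4 * (Lr_norm r A f + Lr_norm r A g)"
  using r
proof (cases rule: exponent_cases)
  case infinite
  have "AE x in lebesgue. x \<in> A \<longrightarrow> f x \<le> Lr_norm r A f" "AE x in lebesgue. x \<in> A \<longrightarrow> g x \<le> Lr_norm r A g"
    unfolding infinite by (rule Lr_norm_AE_le; simp)+
  moreover have "1 * (Lr_norm r A f + Lr_norm r A g) \<le> 4 * (Lr_norm r A f + Lr_norm r A g)"
    by (intro mult_right_mono) auto
  ultimately have "AE x in lebesgue. x \<in> A \<longrightarrow> f x + g x \<le> 4 * (Lr_norm r A f + Lr_norm r A g)"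
    by (auto elim!: eventually_elim2 intro: order_trans add_mono)
  then show ?thesis
    unfolding infinite by (subst Lr_norm_infinity_le_iff) auto
next
  case (finite s)
  let ?F = "Lr_norm r A f" and ?G = "Lr_norm r A g"
  have "(\<integral>\<^sup>+x\<in>A. epow (f x + g x) s \<partial>lebesgue)
      \<le> (\<integral>\<^sup>+x. ennreal (2 powr s) * (epow (f x) s * indicator A x + epow (g x) s * indicator A x) \<partial>lebesgue)"
    using finite by (intro nn_integral_mono) (auto split: split_indicator intro!: epow_add_le)
  also have "\<dots> = epow 2 s * (epow ?F s + epow ?G s)"
    using finite epow_ennreal[of 2 s] by (simp add: nn_integral_add nn_integral_cmult epow_Lr_norm_ereal)
  also have "\<dots> \<le> epow 2 s * epow (2 * (?F + ?G)) s"
    using finite by (intro mult_left_mono epow_add_powers_le) auto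
  also have "\<dots> = epow (4 * (?F + ?G)) s"
    by (simp flip: epow_mult mult.assoc)
  finally show ?thesis
    using finite by (simp add: Lr_norm_ereal_le_iff)
qed

lemma Lr_norm_cmult:
  assumes r: "1 < r"
    and [measurable]: "f \<in> borel_measurable lebesgue" "A \<in> sets lebesgue"
  shows "Lr_norm r A (\<lambda>x. c * f x) \<le> c * Lr_norm r A f"
  using r
proof (cases rule: exponent_cases)
  case infinite
  have "AE x in lebesgue. x \<in> A \<longrightarrow> f x \<le> Lr_norm r A f"
    unfolding infinite by (rule Lr_norm_AE_le; simp)
  then have "AE x in lebesgue. x \<in> A \<longrightarrow> c * f x \<le> c * Lr_norm r A f"
    by (auto elim!: eventually_mono intro: mult_left_mono)
  then show ?thesis
    unfolding infinite by (subst Lr_norm_infinity_le_iff) auto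
next
  case (finite s)
  have "(\<integral>\<^sup>+x\<in>A. epow (c * f x) s \<partial>lebesgue) = epow (c * Lr_norm r A f) s"
    using finite by (simp add: epow_mult epow_Lr_norm_ereal nn_integral_cmult mult.assoc)
  then show ?thesis
    using finite by (simp add: Lr_norm_ereal_le_iff)
qed

text \<open>This carries uniform bounds on the iterates over to their limit: by monotone convergence
  for finite \<open>r\<close>, by a countable union of null sets for
  \<open>r = \<infinity>\<close>.\<close>

lemma Lr_norm_SUP_le:
  assumes r: "1 < r"
    and [measurable]: "\<And>n::nat. f n \<in> borel_measurable lebesgue" "A \<in> sets lebesgue"
    and inc: "\<And>x. incseq (\<lambda>n. f n x)" and le: "\<And>n. Lr_norm r A (f n) \<le> c"
  shows "Lr_norm r A (\<lambda>x. SUP n. f n x) \<le> c"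
  using r
proof (cases rule: exponent_cases)
  case infinite
  have "AE x in lebesgue. x \<in> A \<longrightarrow> f n x \<le> c" for n
    using le[of n] unfolding infinite by (subst (asm) Lr_norm_infinity_le_iff) auto
  then have "AE x in lebesgue. \<forall>n. x \<in> A \<longrightarrow> f n x \<le> c"
    by (subst AE_all_countable) simp
  then have "AE x in lebesgue. x \<in> A \<longrightarrow> (SUP n. f n x) \<le> c"
    by (auto elim!: eventually_mono intro!: SUP_least)
  then show ?thesis
    unfolding infinite by (subst Lr_norm_infinity_le_iff) auto
next
  case (finite s)
  have "(\<integral>\<^sup>+x\<in>A. epow (SUP n. f n x) s \<partial>lebesgue) = (\<integral>\<^sup>+x. (SUP n. epow (f n x) s * indicator A x) \<partial>lebesgue)"
    using finite by (simp add: epow_SUP SUP_mult_right_ennreal)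
  also have "\<dots> = (SUP n. (\<integral>\<^sup>+x. epow (f n x) s * indicator A x \<partial>lebesgue))"
    using inc finite by (intro nn_integral_monotone_convergence_SUP)
      (auto simp: incseq_def le_fun_def intro!: mult_right_mono epow_mono)
  also have "\<dots> \<le> epow c s"
    using le finite by (auto simp: Lr_norm_ereal_le_iff intro!: SUP_least)
  finally show ?thesis
    using finite by (simp add: Lr_norm_ereal_le_iff)
qed

lemma Lr_norm_le_const:
  assumes r: "1 < r"
    and [measurable]: "f \<in> borel_measurable lebesgue" "A \<in> sets lebesgue"
    and le: "\<And>x. x \<in> A \<Longrightarrow> f x \<le> c" and m: "emeasure lebesgue A \<le> ennreal m" "0 < m"
  shows "Lr_norm r A f \<le> c * ennreal (m powr recip r)"
  using r
proof (cases rule: exponent_cases)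
  case infinite
  show ?thesis
    using le m unfolding infinite by (subst Lr_norm_infinity_le_iff) auto
next
  case (finite s)
  have "(\<integral>\<^sup>+x\<in>A. epow (f x) s \<partial>lebesgue) \<le> (\<integral>\<^sup>+x. epow c s * indicator A x \<partial>lebesgue)"
    using finite le by (intro nn_integral_mono) (auto split: split_indicator intro!: epow_mono)
  also have "\<dots> \<le> epow c s * ennreal m"
    using m by (simp add: nn_integral_cmult mult_left_mono)
  also have "\<dots> = epow (c * ennreal (m powr (1 / s))) s"
    using m finite by (simp add: epow_mult powr_powr)
  finally show ?thesis
    using finite by (simp add: Lr_norm_ereal_le_iff)
qed

text \<open>Hoelder's inequality against the indicator of \<open>A\<close>, with exponents
  \<open>p / s\<close> and \<open>1 - p / s\<close>. The volume enters linearly when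
  \<open>r = \<infinity>\<close>.\<close>

lemma nn_integral_epow_le_Lr_norm:
  assumes p: "1 < p" "ereal p < r"
    and [measurable]: "f \<in> borel_measurable lebesgue" "A \<in> sets lebesgue"
    and m: "emeasure lebesgue A \<le> ennreal m" "0 < m"
  shows "(\<integral>\<^sup>+x\<in>A. epow (f x) p \<partial>lebesgue) \<le> epow (Lr_norm r A f) p * ennreal (m powr (1 - p * recip r))"
proof -
  have "1 < r" using p by (rule one_less_exponent)
  then show ?thesis
  proof (cases rule: exponent_cases)
    case infinite
    have "AE x in lebesgue. x \<in> A \<longrightarrow> f x \<le> Lr_norm r A f"
      unfolding infinite by (rule Lr_norm_AE_le; simp)
    then have "(\<integral>\<^sup>+x\<in>A. epow (f x) p \<partial>lebesgue) \<le> (\<integral>\<^sup>+x. epow (Lr_norm r A f) p * indicator A x \<partial>lebesgue)"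
      using p by (intro nn_integral_mono_AE) (auto elim!: eventually_mono split: split_indicator intro!: epow_mono)
    also have "\<dots> \<le> epow (Lr_norm r A f) p * ennreal m"
      using m by (simp add: nn_integral_cmult mult_left_mono)
    finally show ?thesis using m by (simp add: infinite)
  next
    case (finite s)
    then have s: "p < s" "0 < s" using p by auto
    have "(\<integral>\<^sup>+x\<in>A. epow (f x) p \<partial>lebesgue)
        = (\<integral>\<^sup>+x. epow (epow (f x) s * indicator A x) (p / s) * epow (indicator A x) (1 - p / s) \<partial>lebesgue)"
      using s by (intro nn_integral_cong) (auto simp: epow_epow epow_mult split: split_indicator)
    also have "\<dots> \<le> epow (\<integral>\<^sup>+x\<in>A. epow (f x) s \<partial>lebesgue) (p / s) * epow (\<integral>\<^sup>+x. indicator A x \<partial>lebesgue) (1 - p / s)"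
      using s p by (intro Holder_nn_integral) auto
    also have "\<dots> = epow (Lr_norm r A f) p * epow (emeasure lebesgue A) (1 - p / s)"
      using s by (simp add: finite Lr_norm_def epow_epow)
    also have "\<dots> \<le> epow (Lr_norm r A f) p * epow (ennreal m) (1 - p / s)"
      using m s by (intro mult_left_mono epow_mono) auto
    finally show ?thesis using m by (simp add: finite)
  qed
qed

lemma Lr_norm_finite_imp_AE_finite:
  assumes r: "1 < r"
    and [measurable]: "f \<in> borel_measurable lebesgue" "A \<in> sets lebesgue"
    and fin: "Lr_norm r A f < top"
  shows "AE x in lebesgue. x \<in> A \<longrightarrow> f x < top"
  using r
proof (cases rule: exponent_cases)
  case infinite
  have "AE x in lebesgue. x \<in> A \<longrightarrow> f x \<le> Lr_norm r A f"
    unfolding infinite by (rule Lr_norm_AE_le; simp)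
  then show ?thesis using fin by (auto elim!: eventually_mono)
next
  case (finite s)
  have "epow (Lr_norm r A f) s \<noteq> top" using fin by simp
  then have "(\<integral>\<^sup>+x\<in>A. epow (f x) s \<partial>lebesgue) \<noteq> top"
    using finite by (simp add: epow_Lr_norm_ereal)
  then have "AE x in lebesgue. epow (f x) s * indicator A x \<noteq> top"
    using nn_integral_PInf_AE[of "\<lambda>x. epow (f x) s * indicator A x" lebesgue] by simp
  then show ?thesis
    by (auto elim!: eventually_mono simp: less_top[symmetric] split: split_indicator_asm)
qed

lemma Lr_norm_UNIV_indicator:
  assumes r: "1 < r"
    and [measurable]: "f \<in> borel_measurable lebesgue" "A \<in> sets lebesgue"
  shows "Lr_norm r UNIV (\<lambda>x. f x * indicator A x) \<le> Lr_norm r A f"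
  using r
proof (cases rule: exponent_cases)
  case infinite
  have "AE x in lebesgue. x \<in> A \<longrightarrow> f x \<le> Lr_norm r A f"
    unfolding infinite by (rule Lr_norm_AE_le; simp)
  then have "AE x in lebesgue. x \<in> UNIV \<longrightarrow> f x * indicator A x \<le> Lr_norm r A f"
    by (auto elim!: eventually_mono split: split_indicator)
  then show ?thesis
    unfolding infinite by (subst Lr_norm_infinity_le_iff) auto
next
  case (finite s)
  have "(\<integral>\<^sup>+x\<in>UNIV. epow (f x * indicator A x) s \<partial>lebesgue) = (\<integral>\<^sup>+x\<in>A. epow (f x) s \<partial>lebesgue)"
    by (intro nn_integral_cong) (auto split: split_indicator)
  then show ?thesis
    using finite by (simp add: Lr_norm_ereal_le_iff epow_Lr_norm_ereal)
qed

text \<open>Here \<open>g\<close> to the power \<open>p\<close> lies in L^(r/p), and Young's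
  relation 1 + 1/r = 1/q + p/r gives this \<open>q\<close>. For \<open>r = \<infinity>\<close> it is
  1 and the kernel only has to be integrable.\<close>

lemma Young_convolution_Lr_norm:
  fixes k g :: "'a::euclidean_space \<Rightarrow> ennreal"
  assumes [measurable]: "k \<in> borel_measurable borel" "g \<in> borel_measurable borel"
    and p: "1 < p" "ereal p < r" and q: "q = 1 / (1 - (p - 1) * recip r)"
  shows "Lr_norm r UNIV (\<lambda>x. \<integral>\<^sup>+y. k (x - y) * epow (g y) p \<partial>lborel)
    \<le> epow (\<integral>\<^sup>+x. epow (k x) q \<partial>lborel) (1 / q) * epow (Lr_norm r UNIV g) p"
proof -
  have "1 < r" using p by (rule one_less_exponent)
  then show ?thesis
  proof (cases rule: exponent_cases)
    case infinite
    have "AE y in lebesgue. y \<in> UNIV \<longrightarrow> g y \<le> Lr_norm r UNIV g"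
      unfolding infinite by (rule Lr_norm_AE_le) (auto intro: measurable_completion)
    then have *: "AE y in lborel. g y \<le> Lr_norm r UNIV g"
      by (simp add: AE_completion_iff)
    have "(\<integral>\<^sup>+y. k (x - y) * epow (g y) p \<partial>lborel) \<le> integral\<^sup>N lborel k * epow (Lr_norm r UNIV g) p" for x
    proof -
      have "(\<integral>\<^sup>+y. k (x - y) * epow (g y) p \<partial>lborel) \<le> (\<integral>\<^sup>+y. k (x - y) * epow (Lr_norm r UNIV g) p \<partial>lborel)"
        using * p by (intro nn_integral_mono_AE) (auto elim!: eventually_mono intro!: mult_left_mono epow_mono)
      then show ?thesis
        by (simp add: nn_integral_multc nn_integral_lborel_reflect)
    qed
    moreover have "(\<lambda>x. \<integral>\<^sup>+y. k (x - y) * epow (g y) p \<partial>lborel) \<in> borel_measurable lebesgue"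
      by (intro measurable_completion) measurable
    ultimately show ?thesis
      unfolding infinite by (subst Lr_norm_infinity_le_iff) (auto simp: q infinite)
  next
    case (finite s)
    then have s: "p < s" "0 < s" using p by auto
    have qs: "q = s / (s - p + 1)"
      using s p by (simp add: finite q field_simps)
    then have q0: "0 < q" using s p by simp
    have "epow (\<integral>\<^sup>+x. epow (k x) q \<partial>lborel) (s / q) * epow (\<integral>\<^sup>+x. epow (g x) s \<partial>lborel) p
       = epow (epow (\<integral>\<^sup>+x. epow (k x) q \<partial>lborel) (1 / q) * epow (Lr_norm r UNIV g) p) s"
      using s by (simp add: finite epow_mult epow_epow Lr_norm_def nn_integral_completion)
    then show ?thesis
      using Young_convolution_epow[of k g p s q] s p qs
      by (simp add: finite Lr_norm_ereal_le_iff nn_integral_completion)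
  qed
qed

section \<open>The fundamental solution near the origin\<close>

lemma ennreal_le_suminf: "f j \<le> (\<Sum>i. f i :: ennreal)" for j :: nat
  using sum_le_suminf[of f "{j}"] by simp

lemma dyadic_shell_exists:
  fixes t :: real
  assumes "1 \<le> t"
  obtains j :: nat where "2 ^ j \<le> t" "t < 2 ^ Suc j"
proof -
  obtain n where n: "t < 2 ^ n"
    using real_arch_pow[of 2 t] by auto
  define m where "m = (LEAST n. t < 2 ^ n)"
  have m: "t < 2 ^ m" unfolding m_def by (rule LeastI[of _ n]) (rule n)
  with assms obtain j where j: "m = Suc j" by (cases m) auto
  have "\<not> t < 2 ^ j" using not_less_Least[of j "\<lambda>n. t < 2 ^ n"] j by (simp add: m_def)
  with m j show ?thesis by (intro that[of j]) auto
qed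

lemma borel_ball [measurable]: "ball (c :: 'a::metric_space) R \<in> sets borel"
  and borel_cball [measurable]: "cball c R \<in> sets borel"
  by simp_all

lemma dyadic_powr: "(2 ^ j) powr e = (2 powr e) ^ j" for e :: real
  by (simp add: powr_power powr_powr mult.commute flip: powr_realpow)

lemma dyadic_divide_powr: "0 < R \<Longrightarrow> (R / 2 ^ j) powr e = R powr e * (2 powr (- e)) ^ j" for R e :: real
  by (simp add: powr_divide dyadic_powr powr_minus power_inverse field_simps)

lemma emeasure_lborel_cball_powr:
  assumes "0 < R"
  shows "emeasure lborel (cball (0::'a::euclidean_space) R) = ennreal (unit_ball_vol (real DIM('a)) * R powr real DIM('a))"
  using assms by (simp add: emeasure_cball powr_realpow)

text \<open>Dyadic shells around the origin take the place of polar coordinates. Bounding each shell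
  by its enclosing ball gives a geometric series with ratio \<open>2 powr (- (N - s))\<close>, which
  is below 1 since \<open>s < N\<close>.\<close>

lemma nn_integral_norm_powr_ball_le:
  assumes s: "s < real DIM('a::euclidean_space)"
  shows "\<exists>C>0. \<forall>R>0. (\<integral>\<^sup>+z. ennreal (norm (z::'a) powr (- s)) * indicator (ball 0 R) z \<partial>lborel)
           \<le> ennreal (C * R powr (real DIM('a) - s))"
proof -
  define N where "N = real DIM('a)"
  define v where "v = unit_ball_vol N"
  \<comment> \<open>On a shell the power is largest at the inner radius if \<open>s \<ge> 0\<close>,
    which costs \<open>2 powr s\<close>, and at the outer radius if \<open>s < 0\<close>, which
    costs nothing.\<close>
  define \<sigma> where "\<sigma> = max s 0"
  have v: "0 < v" by (simp add: v_def N_def)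
  define a where "a = 2 powr (- (N - s))"
  have a: "0 < a" "a < 1" using s by (auto simp: a_def N_def powr_less_one)
  define C where "C = v * 2 powr \<sigma> / (1 - a)"
  have "(\<integral>\<^sup>+z. ennreal (norm (z::'a) powr (- s)) * indicator (ball 0 R) z \<partial>lborel) \<le> ennreal (C * R powr (N - s))"
    if R: "0 < R" for R
  proof -
    define b where "b j = 2 powr \<sigma> * (R / 2 ^ j) powr (- s)" for j :: nat
    have b0: "0 \<le> b j" for j by (simp add: b_def)
    have le: "ennreal (norm (z::'a) powr (- s)) * indicator (ball 0 R) z
        \<le> (\<Sum>j. ennreal (b j) * indicator (cball 0 (R / 2 ^ j)) z)" for z
    \<comment> \<open>At the origin, which lies in no shell, the integrand is 0 because
      \<open>0 powr (- s) = 0\<close>.\<close>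
    proof (cases "z \<noteq> 0 \<and> norm z < R")
      case True
      then have "1 \<le> R / norm z" by simp
      then obtain j where j: "2 ^ j \<le> R / norm z" "R / norm z < 2 ^ Suc j"
        by (rule dyadic_shell_exists)
      then have z: "norm z \<le> R / 2 ^ j" "R / 2 ^ j / 2 < norm z"
        using True by (auto simp: field_simps)
      have "norm z powr (- s) \<le> b j"
      proof (cases "0 \<le> s")
        case s: True
        have "norm z powr (- s) \<le> (R / 2 ^ j / 2) powr (- s)"
          using s z R by (intro powr_mono2') auto
        also have "\<dots> = b j"
          using s R by (simp add: b_def \<sigma>_def powr_divide powr_minus powr_mult field_simps)
        finally show ?thesis .
      next
        case False
        then have "norm z powr (- s) \<le> (R / 2 ^ j) powr (- s)"
          using z by (intro powr_mono2) auto
        with False show ?thesis by (simp add: b_def \<sigma>_def)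
      qed
      then have "ennreal (norm z powr (- s)) * indicator (ball 0 R) z
          \<le> ennreal (b j) * indicator (cball 0 (R / 2 ^ j)) z"
        using z b0 by (auto simp: ennreal_leI split: split_indicator)
      also have "\<dots> \<le> (\<Sum>j. ennreal (b j) * indicator (cball 0 (R / 2 ^ j)) z)"
        by (rule ennreal_le_suminf[of "\<lambda>j. ennreal (b j) * indicator (cball 0 (R / 2 ^ j)) z"])
      finally show ?thesis .
    qed (auto split: split_indicator)
    have "(\<integral>\<^sup>+z. ennreal (norm (z::'a) powr (- s)) * indicator (ball 0 R) z \<partial>lborel)
        \<le> (\<integral>\<^sup>+z. (\<Sum>j. ennreal (b j) * indicator (cball 0 (R / 2 ^ j)) (z::'a)) \<partial>lborel)"
      by (intro nn_integral_mono le)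
    also have "\<dots> = (\<Sum>j. ennreal (b j) * emeasure lborel (cball (0::'a) (R / 2 ^ j)))"
      by (subst nn_integral_suminf) (simp_all add: nn_integral_cmult)
    also have "\<dots> = (\<Sum>j. ennreal (v * 2 powr \<sigma> * R powr (N - s) * a ^ j))"
    proof (rule suminf_cong)
      fix j :: nat
      have "b j * (v * (R / 2 ^ j) powr N) = v * 2 powr \<sigma> * (R / 2 ^ j) powr (N - s)"
        using R by (simp add: b_def powr_diff powr_minus field_simps)
      also have "(R / 2 ^ j) powr (N - s) = R powr (N - s) * a ^ j"
        using R unfolding a_def by (rule dyadic_divide_powr)
      finally have eq: "b j * (v * (R / 2 ^ j) powr N) = v * 2 powr \<sigma> * R powr (N - s) * a ^ j"
        by (simp only: mult.assoc)
      have "ennreal (b j) * emeasure lborel (cball (0::'a) (R / 2 ^ j)) = ennreal (b j * (v * (R / 2 ^ j) powr N))"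
        using R b0 v by (simp add: emeasure_lborel_cball_powr ennreal_mult N_def v_def)
      then show "ennreal (b j) * emeasure lborel (cball (0::'a) (R / 2 ^ j)) = ennreal (v * 2 powr \<sigma> * R powr (N - s) * a ^ j)"
        by (simp only: eq)
    qed
    also have "\<dots> = ennreal (v * 2 powr \<sigma> * R powr (N - s) * (1 / (1 - a)))"
      using a v by (intro suminf_ennreal_eq sums_mult geometric_sums) auto
    also have "v * 2 powr \<sigma> * R powr (N - s) * (1 / (1 - a)) = C * R powr (N - s)"
      by (simp add: C_def)
    finally show ?thesis .
  qed
  moreover have "0 < C" using a v by (simp add: C_def)
  ultimately show ?thesis unfolding N_def by auto
qed

lemma fund_sol_eq_powr:
  assumes "DIM('a::euclidean_space) \<ge> 3"
  obtains c where "0 < c" "\<And>x::'a. x \<noteq> 0 \<Longrightarrow> fund_sol x = ennreal (c * norm x powr (2 - real DIM('a)))"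
proof
  have "0 < measure lborel (ball (0::'a) 1)" by (simp add: content_ball)
  then show "0 < 1 / (real DIM('a) * (real DIM('a) - 2) * measure lborel (ball (0::'a) 1))"
    using assms by simp
qed (simp add: fund_sol_def)

lemma measurable_fund_sol [measurable]: "fund_sol \<in> borel_measurable borel"
  unfolding fund_sol_def by measurable

lemma fund_sol_truncated_norm_le:
  assumes N: "DIM('a::euclidean_space) \<ge> 3" and \<tau>: "0 \<le> \<tau>" "\<tau> < 2 / real DIM('a)" and q: "q = 1 / (1 - \<tau>)"
  shows "\<exists>C>0. \<forall>R>0. epow (\<integral>\<^sup>+z. epow (fund_sol z * indicator (ball 0 R) (z::'a)) q \<partial>lborel) (1 / q)
           \<le> ennreal (C * R powr (2 - real DIM('a) * \<tau>))"
proof -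
  define N where "N = real DIM('a)"
  have N3: "3 \<le> N" using N by (simp add: N_def)
  obtain c where c: "0 < c" "\<And>x::'a. x \<noteq> 0 \<Longrightarrow> fund_sol x = ennreal (c * norm x powr (2 - N))"
    using fund_sol_eq_powr[OF N] unfolding N_def by auto
  have \<tau>1: "N * \<tau> < 2" "\<tau> < 1"
  proof -
    show "N * \<tau> < 2" using \<tau> N3 by (simp add: N_def field_simps)
    have "2 / N < 1" using N3 by simp
    moreover have "\<tau> < 2 / N" using \<tau> by (simp add: N_def)
    ultimately show "\<tau> < 1" by linarith
  qed
  have q0: "0 < q" and invq: "1 / q = 1 - \<tau>" using \<tau>1 by (auto simp: q)
  define s where "s = q * (N - 2)"
  \<comment> \<open>The number (N - s)/q = 2 - N\<tau> has two roles: its positivity is the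
    integrability of the q-th power of \<Gamma> at the origin, and it is the power of
    \<open>R\<close> in the norm of the truncated kernel.\<close>
  have "(N - s) * (1 / q) = N * (1 / q) - (N - 2)"
    using q0 by (simp add: s_def left_diff_distrib diff_divide_distrib)
  then have Ns: "(N - s) * (1 / q) = 2 - N * \<tau>"
    unfolding invq by (simp add: algebra_simps)
  have "0 < (N - s) * (1 / q)" using \<tau>1 Ns by simp
  then have "s < N" using q0 by (simp add: zero_less_divide_iff)
  then obtain C where C: "0 < C" "\<And>R. 0 < R \<Longrightarrow> (\<integral>\<^sup>+z. ennreal (norm (z::'a) powr (- s)) * indicator (ball 0 R) z \<partial>lborel)
           \<le> ennreal (C * R powr (N - s))"
    using nn_integral_norm_powr_ball_le[where 'a='a, of s] by (auto simp: N_def)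
  have "epow (\<integral>\<^sup>+z. epow (fund_sol z * indicator (ball 0 R) (z::'a)) q \<partial>lborel) (1 / q)
      \<le> ennreal (c * C powr (1 / q) * R powr (2 - N * \<tau>))" if R: "0 < R" for R
  proof -
    \<comment> \<open>The origin, where \<open>fund_sol\<close> is infinite and the power formula
      fails, is a null set.\<close>
    have "AE z::'a in lborel. z \<noteq> 0" by (rule AE_lborel_singleton)
    then have "(\<integral>\<^sup>+z. epow (fund_sol z * indicator (ball 0 R) (z::'a)) q \<partial>lborel)
       = (\<integral>\<^sup>+z. ennreal (c powr q) * (ennreal (norm z powr (- s)) * indicator (ball 0 R) (z::'a)) \<partial>lborel)"
    proof (intro nn_integral_cong_AE, eventually_elim)
      fix z :: 'a assume "z \<noteq> 0"
      then have "epow (fund_sol z) q = ennreal (c powr q) * ennreal (norm z powr (- s))"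
        using c(1) by (simp add: c(2) s_def powr_mult powr_powr flip: ennreal_mult) (simp add: algebra_simps)
      then show "epow (fund_sol z * indicator (ball 0 R) z) q
          = ennreal (c powr q) * (ennreal (norm z powr (- s)) * indicator (ball 0 R) z)"
        by (auto split: split_indicator)
    qed
    also have "\<dots> = ennreal (c powr q) * (\<integral>\<^sup>+z. ennreal (norm z powr (- s)) * indicator (ball 0 R) (z::'a) \<partial>lborel)"
      by (rule nn_integral_cmult) measurable
    also have "\<dots> \<le> ennreal (c powr q) * ennreal (C * R powr (N - s))"
      by (intro mult_left_mono C R) auto
    finally have "epow (\<integral>\<^sup>+z. epow (fund_sol z * indicator (ball 0 R) (z::'a)) q \<partial>lborel) (1 / q)
       \<le> epow (ennreal (c powr q) * ennreal (C * R powr (N - s))) (1 / q)"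
      using q0 by (intro epow_mono) auto
    also have "\<dots> = ennreal (c * (C powr (1 / q) * R powr ((N - s) * (1 / q))))"
      using c C q0 by (simp add: powr_mult powr_powr epow_mult flip: ennreal_mult)
    finally show ?thesis by (simp only: Ns mult.assoc)
  qed
  moreover have "0 < c * C powr (1 / q)" using c C by simp
  ultimately show ?thesis unfolding N_def by blast
qed

section \<open>Growth on dyadic shells\<close>

text \<open>Cutting the norm off at 1 makes the innermost shell a full ball, so local integrability
  and growth at infinity become a single family of conditions.\<close>

definition wt :: "'a::real_normed_vector \<Rightarrow> real" where
  "wt x = max 1 (norm x)"

text \<open>For \<open>R > 1\<close> the shell is the annulus \<open>A(0,2R)\<close>, and for \<open>R = 1\<close> it is the ball \<open>B(0,2)\<close>.\<close>

definition shell :: "real \<Rightarrow> 'a::real_normed_vector set" where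
  "shell R = {x. R \<le> wt x \<and> wt x < 2 * R}"

lemma wt_ge_1: "1 \<le> wt x" and wt_pos: "0 < wt x" and norm_le_wt: "norm x \<le> wt x"
  by (auto simp: wt_def)

lemma wt_triangle: "wt y \<le> wt x + norm (x - y)"
proof -
  have "norm y \<le> norm x + norm (x - y)"
    using norm_triangle_ineq4[of x "x - y"] by simp
  then show ?thesis
    using norm_ge_zero[of "x - y"] unfolding wt_def by linarith
qed

lemma measurable_wt [measurable]: "wt \<in> borel_measurable borel"
  unfolding wt_def[abs_def] by measurable

lemma shell_borel [measurable]: "shell R \<in> sets borel"
  unfolding shell_def by measurable

lemma lmeasurable_shell [measurable]: "shell R \<in> sets lebesgue"
  using shell_borel by simp

lemma emeasure_shell_le:
  assumes "0 < R"
  shows "emeasure lebesgue (shell R :: 'a::euclidean_space set)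
    \<le> ennreal (unit_ball_vol (real DIM('a)) * (2 * R) powr real DIM('a))"
proof -
  have "shell R \<subseteq> cball (0::'a) (2 * R)"
  proof
    fix x :: 'a assume "x \<in> shell R"
    then show "x \<in> cball 0 (2 * R)" using norm_le_wt[of x] by (simp add: shell_def)
  qed
  then have "emeasure lborel (shell R :: 'a set) \<le> emeasure lborel (cball (0::'a) (2 * R))"
    by (intro emeasure_mono) auto
  then show ?thesis
    using assms by (simp only: emeasure_lborel_cball_powr) simp
qed

lemma shell_cover:
  obtains j where "x \<in> shell (2 ^ j)"
proof -
  obtain j where "2 ^ j \<le> wt x" "wt x < 2 ^ Suc j"
    using wt_ge_1 by (rule dyadic_shell_exists)
  then show ?thesis by (intro that[of j]) (auto simp: shell_def)
qed

text \<open>An averaged form of u = O(|x|^\<theta>): the volume of the shell to the power 1/r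
  accounts for the factor R^(N/r).\<close>

definition shell_bounded :: "ereal \<Rightarrow> real \<Rightarrow> real \<Rightarrow> ('a::euclidean_space \<Rightarrow> ennreal) \<Rightarrow> bool" where
  "shell_bounded r \<theta> M u \<longleftrightarrow>
     (\<forall>R\<ge>1. Lr_norm r (shell R) u \<le> ennreal (M * R powr (real DIM('a) * recip r + \<theta>)))"

lemma shell_boundedD:
  "shell_bounded r \<theta> M (u :: 'a::euclidean_space \<Rightarrow> ennreal) \<Longrightarrow> 1 \<le> R \<Longrightarrow>
     Lr_norm r (shell R) u \<le> ennreal (M * R powr (real DIM('a) * recip r + \<theta>))"
  by (simp add: shell_bounded_def)

lemma powr_comparable_le:
  fixes R :: real
  assumes "0 < R" "R / 2 \<le> t" "t \<le> 4 * R"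
  shows "t powr \<beta> \<le> 4 powr \<bar>\<beta>\<bar> * R powr \<beta>"
proof (cases "0 \<le> \<beta>")
  case True
  then have "t powr \<beta> \<le> (4 * R) powr \<beta>" using assms by (intro powr_mono2) auto
  with True assms show ?thesis by (simp add: powr_mult)
next
  case False
  then have "t powr \<beta> \<le> (R / 2) powr \<beta>" using assms by (intro powr_mono2') auto
  also have "\<dots> = 2 powr (- \<beta>) * R powr \<beta>"
    using assms by (simp add: powr_divide powr_minus field_simps)
  also have "\<dots> \<le> 4 powr (- \<beta>) * R powr \<beta>"
    using False by (intro mult_right_mono powr_mono2) auto
  finally show ?thesis using False by simp
qed

lemma shell_bounded_fat:
  fixes u :: "'a::euclidean_space \<Rightarrow> ennreal"
  assumes r: "1 < r" and [measurable]: "u \<in> borel_measurable lebesgue"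
    and u: "shell_bounded r \<theta> M u" and M: "0 \<le> M" and R: "1 \<le> R"
  shows "Lr_norm r {x. R / 2 \<le> wt x \<and> wt x < 4 * R} u
    \<le> ennreal (10 * 4 powr \<bar>real DIM('a) * recip r + \<theta>\<bar> * M * R powr (real DIM('a) * recip r + \<theta>))"
proof -
  define \<beta> where "\<beta> = real DIM('a) * recip r + \<theta>"
  \<comment> \<open>Bounds are available only for radii at least 1. Since \<open>wt\<close> is never
    below 1, starting at \<open>T\<close> loses nothing, and the shells at \<open>T\<close>,
    \<open>2 * T\<close>, \<open>4 * T\<close> reach \<open>8 * T \<ge> 4 * R\<close>.\<close>
  define T where "T = max 1 (R / 2)"
  define B where "B = 4 powr \<bar>\<beta>\<bar> * M * R powr \<beta>"
  have B0: "0 \<le> B" using M by (simp add: B_def)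
  have piece: "Lr_norm r (shell t) u \<le> ennreal B" if "t \<in> {T, 2 * T, 4 * T}" for t
  proof -
    have "1 \<le> t" "R / 2 \<le> t" "t \<le> 4 * R" using that R by (auto simp: T_def max_def split: if_splits)
    then have "M * t powr \<beta> \<le> M * (4 powr \<bar>\<beta>\<bar> * R powr \<beta>)"
      using R M by (intro mult_left_mono powr_comparable_le) auto
    then show ?thesis
      using shell_boundedD[OF u \<open>1 \<le> t\<close>]
      by (auto simp: B_def \<beta>_def mult_ac intro: order_trans ennreal_leI)
  qed
  have "{x::'a. R / 2 \<le> wt x \<and> wt x < 4 * R} \<subseteq> shell T \<union> (shell (2 * T) \<union> shell (4 * T))"
  proof
    fix x :: 'a assume "x \<in> {x. R / 2 \<le> wt x \<and> wt x < 4 * R}"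
    then have "T \<le> wt x" "wt x < 8 * T" using wt_ge_1[of x] by (auto simp: T_def)
    then show "x \<in> shell T \<union> (shell (2 * T) \<union> shell (4 * T))" by (auto simp: shell_def)
  qed
  then have "Lr_norm r {x. R / 2 \<le> wt x \<and> wt x < 4 * R} u \<le> Lr_norm r (shell T \<union> (shell (2 * T) \<union> shell (4 * T))) u"
    by (intro Lr_norm_mono_AE r) auto
  also have "\<dots> \<le> 2 * (Lr_norm r (shell T) u + Lr_norm r (shell (2 * T) \<union> shell (4 * T)) u)"
    by (rule Lr_norm_Un[OF r]) auto
  also have "\<dots> \<le> 2 * (Lr_norm r (shell T) u + 2 * (Lr_norm r (shell (2 * T)) u + Lr_norm r (shell (4 * T)) u))"
    by (intro mult_left_mono add_left_mono Lr_norm_Un r) auto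
  also have "\<dots> \<le> 2 * (ennreal B + 2 * (ennreal B + ennreal B))"
    by (intro mult_left_mono add_mono piece) auto
  also have "\<dots> = ennreal (2 * (B + 2 * (B + B)))"
    using B0 by (simp add: ennreal_mult distrib_left) (simp flip: distrib_right)
  also have "2 * (B + 2 * (B + B)) = 10 * 4 powr \<bar>\<beta>\<bar> * M * R powr \<beta>"
    by (simp add: B_def)
  finally show ?thesis by (simp add: \<beta>_def)
qed

section \<open>The potential of a power in the shell norm: far and near parts\<close>

text \<open>The dyadic sum converges because \<open>\<theta> < - 2 / (p - 1)\<close>.\<close>

lemma weighted_mass_le:
  assumes p: "1 < p" "ereal p < r"
    and \<theta>: "2 - real DIM('a::euclidean_space) \<le> \<theta>" "2 + (p - 1) * \<theta> < 0"
  shows "\<exists>C>0. \<forall>M\<ge>0. \<forall>u\<in>borel_measurable lebesgue. shell_bounded r \<theta> M u \<longrightarrow>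
     (\<integral>\<^sup>+y. ennreal (wt (y::'a) powr (2 - real DIM('a) - \<theta>)) * epow (u y) p \<partial>lebesgue) \<le> ennreal (C * M powr p)"
proof -
  define N where "N = real DIM('a)"
  define v where "v = unit_ball_vol N * 2 powr N"
  have v: "0 < v" by (simp add: v_def N_def)
  define e where "e = 1 - p * recip r"
  define a where "a = 2 powr (2 + (p - 1) * \<theta>)"
  have a: "0 < a" "a < 1" using \<theta> by (auto simp: a_def powr_less_one)
  define C where "C = v powr e / (1 - a)"
  have "(\<integral>\<^sup>+y. ennreal (wt y powr (2 - N - \<theta>)) * epow (u y) p \<partial>lebesgue) \<le> ennreal (C * M powr p)"
    if M: "0 \<le> M" and [measurable]: "u \<in> borel_measurable lebesgue" and u: "shell_bounded r \<theta> M u" for M and u :: "'a \<Rightarrow> ennreal"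
  proof -
    have [measurable]: "wt \<in> borel_measurable (lebesgue :: 'a measure)"
      by (intro measurable_completion) simp
    define b where "b j = (2 ^ j) powr (2 - N - \<theta>)" for j :: nat
    have b0: "0 \<le> b j" for j by (simp add: b_def)
    have le: "ennreal (wt y powr (2 - N - \<theta>)) * epow (u y) p
        \<le> (\<Sum>j. ennreal (b j) * (epow (u y) p * indicator (shell (2 ^ j)) y))" for y
    proof -
      obtain j where j: "y \<in> shell (2 ^ j)" by (rule shell_cover)
      \<comment> \<open>The lower bound on \<theta> makes the exponent
        \<open>2 - N - \<theta>\<close> nonpositive, so the weight is largest at the inner radius of
        the shell.\<close>
      then have "wt y powr (2 - N - \<theta>) \<le> b j"
        unfolding b_def using \<theta> by (intro powr_mono2') (auto simp: N_def shell_def)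
      then have "ennreal (wt y powr (2 - N - \<theta>)) * epow (u y) p
         \<le> ennreal (b j) * (epow (u y) p * indicator (shell (2 ^ j)) y)"
        using j by (auto intro!: mult_right_mono ennreal_leI)
      also have "\<dots> \<le> (\<Sum>j. ennreal (b j) * (epow (u y) p * indicator (shell (2 ^ j)) y))"
        by (rule ennreal_le_suminf[of "\<lambda>j. ennreal (b j) * (epow (u y) p * indicator (shell (2 ^ j)) y)"])
      finally show ?thesis .
    qed
    have "(\<integral>\<^sup>+y. ennreal (wt y powr (2 - N - \<theta>)) * epow (u y) p \<partial>lebesgue)
        \<le> (\<integral>\<^sup>+y. (\<Sum>j. ennreal (b j) * (epow (u y) p * indicator (shell (2 ^ j)) y)) \<partial>lebesgue)"
      by (intro nn_integral_mono le)
    also have "\<dots> = (\<Sum>j. ennreal (b j) * (\<integral>\<^sup>+y\<in>shell (2 ^ j). epow (u y) p \<partial>lebesgue))"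
      by (subst nn_integral_suminf) (simp_all add: nn_integral_cmult)
    also have "\<dots> \<le> (\<Sum>j. ennreal (v powr e * M powr p * a ^ j))"
    proof (intro suminf_le)
      fix j :: nat
      let ?R = "2 ^ j :: real"
      have "(\<integral>\<^sup>+y\<in>shell ?R. epow (u y) p \<partial>lebesgue)
         \<le> epow (Lr_norm r (shell ?R) u) p * ennreal ((v * ?R powr N) powr e)"
        unfolding e_def using emeasure_shell_le[of ?R, where 'a='a] v
        by (intro nn_integral_epow_le_Lr_norm p) (auto simp: v_def N_def powr_mult mult_ac)
      also have "\<dots> \<le> epow (ennreal (M * ?R powr (N * recip r + \<theta>))) p * ennreal ((v * ?R powr N) powr e)"
        unfolding N_def using p by (intro mult_right_mono epow_mono shell_boundedD u) auto
      also have "\<dots> = ennreal (v powr e * M powr p * (?R powr (p * (N * recip r + \<theta>) + N * e)))"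
        using M v by (simp add: powr_mult powr_powr powr_add distrib_left mult_ac flip: ennreal_mult)
      finally have "ennreal (b j) * (\<integral>\<^sup>+y\<in>shell ?R. epow (u y) p \<partial>lebesgue)
         \<le> ennreal (b j) * ennreal (v powr e * M powr p * (?R powr (p * (N * recip r + \<theta>) + N * e)))"
        by (rule mult_left_mono) simp
      also have "\<dots> = ennreal (v powr e * M powr p * (?R powr (2 - N - \<theta>) * ?R powr (p * (N * recip r + \<theta>) + N * e)))"
        using v by (simp add: b_def mult_ac flip: ennreal_mult)
      also have "?R powr (2 - N - \<theta>) * ?R powr (p * (N * recip r + \<theta>) + N * e)
          = ?R powr ((2 - N - \<theta>) + (p * (N * recip r + \<theta>) + N * e))"
        by (simp only: powr_add)
      \<comment> \<open>The volume factor N(1 - p/r) cancels both the -N of the weight and the pN/r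
        of the norm bound, so \<theta> alone decides convergence.\<close>
      also have "(2 - N - \<theta>) + (p * (N * recip r + \<theta>) + N * e) = 2 + (p - 1) * \<theta>"
        by (simp add: e_def algebra_simps)
      also have "?R powr (2 + (p - 1) * \<theta>) = a ^ j"
        unfolding a_def by (rule dyadic_powr)
      finally show "ennreal (b j) * (\<integral>\<^sup>+y\<in>shell ?R. epow (u y) p \<partial>lebesgue) \<le> ennreal (v powr e * M powr p * a ^ j)" .
    qed auto
    also have "\<dots> = ennreal (v powr e * M powr p * (1 / (1 - a)))"
      using a v by (intro suminf_ennreal_eq sums_mult geometric_sums) auto
    also have "v powr e * M powr p * (1 / (1 - a)) = C * M powr p"
      by (simp add: C_def)
    finally show ?thesis .
  qed
  moreover have "0 < C" using a v by (simp add: C_def)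
  ultimately show ?thesis unfolding N_def by blast
qed

text \<open>In the far region both \<open>wt x\<close> and \<open>wt y\<close> are at most three
  times the distance of \<open>x\<close> and \<open>y\<close>. The exponent 2 - N is the sum of
  \<theta> and 2 - N - \<theta>, both nonpositive, so one can be spent on each weight.\<close>

lemma fund_sol_far_le:
  assumes N: "DIM('a::euclidean_space) \<ge> 3" and \<theta>: "2 - real DIM('a) \<le> \<theta>" "\<theta> \<le> 0"
  shows "\<exists>C>0. \<forall>x y::'a. wt x / 2 \<le> norm (x - y) \<longrightarrow>
     fund_sol (x - y) \<le> ennreal (C * wt x powr \<theta> * wt y powr (2 - real DIM('a) - \<theta>))"
proof -
  define N where "N = real DIM('a)"
  have N3: "3 \<le> N" using N by (simp add: N_def)
  obtain c where c: "0 < c" "\<And>x::'a. x \<noteq> 0 \<Longrightarrow> fund_sol x = ennreal (c * norm x powr (2 - N))"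
    using fund_sol_eq_powr[OF N] unfolding N_def by auto
  define C where "C = c * (1 / 3) powr (2 - N)"
  have "fund_sol (x - y) \<le> ennreal (C * wt x powr \<theta> * wt y powr (2 - N - \<theta>))"
    if far: "wt x / 2 \<le> norm (x - y)" for x y :: 'a
  proof -
    define d where "d = norm (x - y)"
    have d: "0 < d" using far wt_pos[of x] unfolding d_def by (cases "x = y") auto
    have "wt x \<le> 3 * d" "wt y \<le> 3 * d"
      using far wt_triangle[of y x] d unfolding d_def by linarith+
    then have "(3 * d) powr \<theta> \<le> wt x powr \<theta>" "(3 * d) powr (2 - N - \<theta>) \<le> wt y powr (2 - N - \<theta>)"
      using \<theta> wt_pos[of x] wt_pos[of y] by (auto intro!: powr_mono2' simp: N_def)
    then have "(3 * d) powr \<theta> * (3 * d) powr (2 - N - \<theta>) \<le> wt x powr \<theta> * wt y powr (2 - N - \<theta>)"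
      by (intro mult_mono) auto
    then have "(3 * d) powr (2 - N) \<le> wt x powr \<theta> * wt y powr (2 - N - \<theta>)"
      by (simp flip: powr_add)
    then have "C * (3 * d) powr (2 - N) \<le> C * (wt x powr \<theta> * wt y powr (2 - N - \<theta>))"
      using c by (intro mult_left_mono) (auto simp: C_def)
    moreover have "C * (3 * d) powr (2 - N) = c * d powr (2 - N)"
      using d by (simp add: C_def powr_mult powr_divide)
    moreover have "fund_sol (x - y) = ennreal (c * d powr (2 - N))"
      using d c(2)[of "x - y"] by (auto simp: d_def)
    ultimately show ?thesis by (simp add: mult.assoc ennreal_leI)
  qed
  moreover have "0 < C" using c by (simp add: C_def)
  ultimately show ?thesis unfolding N_def by blast
qed

text \<open>The cutoff depends on \<open>x\<close>, so the near part is not a convolution. For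
  \<open>x\<close> in the shell, however, it forces |x - y| < R and puts \<open>y\<close> in the
  enlarged shell; truncating the kernel at \<open>R\<close> and \<open>u\<close> to that set gives a
  convolution that dominates it.\<close>

lemma shell_norm_near_part_le:
  assumes N: "DIM('a::euclidean_space) \<ge> 3" and p: "1 < p" "ereal p < r"
    and \<tau>: "\<tau> = (p - 1) * recip r" "\<tau> < 2 / real DIM('a)"
  shows "\<exists>C>0. \<forall>R\<ge>1. \<forall>u::'a \<Rightarrow> ennreal. u \<in> borel_measurable borel \<longrightarrow>
     Lr_norm r (shell R) (\<lambda>x. \<integral>\<^sup>+y. fund_sol (x - y) * epow (u y) p * indicator {y. norm (x - y) < wt x / 2} y \<partial>lborel)
      \<le> ennreal (C * R powr (2 - real DIM('a) * \<tau>)) * epow (Lr_norm r {x. R / 2 \<le> wt x \<and> wt x < 4 * R} u) p"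
proof -
  define N where "N = real DIM('a)"
  have r: "1 < r" using p by (rule one_less_exponent)
  then have "0 \<le> recip r" by (cases rule: exponent_cases) auto
  then have \<tau>0: "0 \<le> \<tau>" using p by (simp add: \<tau>)
  define q where "q = 1 / (1 - \<tau>)"
  obtain C where C: "0 < C" "\<And>R. 0 < R \<Longrightarrow> epow (\<integral>\<^sup>+z. epow (fund_sol z * indicator (ball 0 R) (z::'a)) q \<partial>lborel) (1 / q)
           \<le> ennreal (C * R powr (2 - N * \<tau>))"
    using fund_sol_truncated_norm_le[OF N \<tau>0 \<tau>(2) q_def] by (auto simp: N_def)
  have "Lr_norm r (shell R) (\<lambda>x. \<integral>\<^sup>+y. fund_sol (x - y) * epow (u y) p * indicator {y. norm (x - y) < wt x / 2} y \<partial>lborel)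
      \<le> ennreal (C * R powr (2 - N * \<tau>)) * epow (Lr_norm r {x. R / 2 \<le> wt x \<and> wt x < 4 * R} u) p"
    if R: "1 \<le> R" and [measurable]: "u \<in> borel_measurable borel" for R and u :: "'a \<Rightarrow> ennreal"
  proof -
    define F where "F = {x::'a. R / 2 \<le> wt x \<and> wt x < 4 * R}"
    define k where "k z = fund_sol z * indicator (ball 0 R) (z::'a)" for z
    define g where "g y = u y * indicator F y" for y
    have [measurable]: "F \<in> sets borel" unfolding F_def by measurable
    then have [measurable]: "F \<in> sets lebesgue" by simp
    have [measurable]: "k \<in> borel_measurable borel" "g \<in> borel_measurable borel"
      unfolding k_def[abs_def] g_def[abs_def] by measurable
    have ul: "u \<in> borel_measurable lebesgue" by (intro measurable_completion) simp
    let ?near = "\<lambda>x. \<integral>\<^sup>+y. fund_sol (x - y) * epow (u y) p * indicator {y. norm (x - y) < wt x / 2} y \<partial>lborel"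
    let ?conv = "\<lambda>x. \<integral>\<^sup>+y. k (x - y) * epow (g y) p \<partial>lborel"
    have "fund_sol (x - y) * epow (u y) p * indicator {y. norm (x - y) < wt x / 2} y \<le> k (x - y) * epow (g y) p"
      if x: "x \<in> shell R" for x y
    proof (cases "norm (x - y) < wt x / 2")
      case True
      have "y \<in> F" "norm (x - y) < R"
        using True x wt_triangle[of y x] wt_triangle[of x y]
        by (auto simp: F_def shell_def norm_minus_commute)
      then show ?thesis using True by (simp add: k_def g_def)
    qed simp
    then have "?near x \<le> ?conv x" if "x \<in> shell R" for x
      using that by (intro nn_integral_mono) auto
    then have "Lr_norm r (shell R) ?near \<le> Lr_norm r UNIV ?conv"
      by (intro Lr_norm_mono_AE r measurable_completion) auto
    also have "\<dots> \<le> epow (\<integral>\<^sup>+x. epow (k x) q \<partial>lborel) (1 / q) * epow (Lr_norm r UNIV g) p"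
      by (intro Young_convolution_Lr_norm p) (auto simp: q_def \<tau>)
    also have "\<dots> \<le> ennreal (C * R powr (2 - N * \<tau>)) * epow (Lr_norm r F u) p"
      using C(2)[of R] R p unfolding k_def g_def[abs_def]
      by (intro mult_mono epow_mono Lr_norm_UNIV_indicator r ul) auto
    finally show ?thesis by (simp add: F_def)
  qed
  with C(1) show ?thesis unfolding N_def by blast
qed

text \<open>The exponent \<theta> is reproduced, and only the constant changes, from
  \<open>M\<close> to a multiple of \<open>M powr p\<close>. This superlinearity is what makes small
  bounds invariant.\<close>

lemma shell_bounded_fund_sol_conv:
  assumes N: "DIM('a::euclidean_space) \<ge> 3" and p: "1 < p" "ereal p < r"
    and r: "(p - 1) * recip r < 2 / real DIM('a)"
    and \<theta>: "2 - real DIM('a) \<le> \<theta>" "2 + (p - 1) * \<theta> < 0"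
  shows "\<exists>C>0. \<forall>M\<ge>0. \<forall>u::'a \<Rightarrow> ennreal. u \<in> borel_measurable borel \<longrightarrow> shell_bounded r \<theta> M u \<longrightarrow>
     shell_bounded r \<theta> (C * M powr p) (\<lambda>x. \<integral>\<^sup>+y. fund_sol (x - y) * epow (u y) p \<partial>lborel)"
proof -
  define N where "N = real DIM('a)"
  define \<tau> where "\<tau> = (p - 1) * recip r"
  define \<beta> where "\<beta> = N * recip r + \<theta>"
  define v where "v = unit_ball_vol N * 2 powr N"
  have v: "0 < v" by (simp add: v_def N_def)
  have r1: "1 < r" using p by (rule one_less_exponent)
  have \<theta>0: "\<theta> \<le> 0"
  proof (rule ccontr)
    assume "\<not> \<theta> \<le> 0"
    then have "0 \<le> (p - 1) * \<theta>" using p by simp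
    with \<theta> show False by simp
  qed
  obtain C1 where C1: "0 < C1" "\<And>x y::'a. wt x / 2 \<le> norm (x - y) \<Longrightarrow>
     fund_sol (x - y) \<le> ennreal (C1 * wt x powr \<theta> * wt y powr (2 - N - \<theta>))"
    using fund_sol_far_le[OF N \<theta>(1) \<theta>0] by (auto simp: N_def)
  obtain C2 where C2: "0 < C2" "\<And>R u::'a \<Rightarrow> ennreal. 1 \<le> R \<Longrightarrow> u \<in> borel_measurable borel \<Longrightarrow>
     Lr_norm r (shell R) (\<lambda>x. \<integral>\<^sup>+y. fund_sol (x - y) * epow (u y) p * indicator {y. norm (x - y) < wt x / 2} y \<partial>lborel)
      \<le> ennreal (C2 * R powr (2 - N * \<tau>)) * epow (Lr_norm r {x. R / 2 \<le> wt x \<and> wt x < 4 * R} u) p"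
    using shell_norm_near_part_le[where 'a='a, OF N p \<tau>_def] r by (auto simp: N_def \<tau>_def)
  obtain C3 where C3: "0 < C3" "\<And>M u. 0 \<le> M \<Longrightarrow> u \<in> borel_measurable lebesgue \<Longrightarrow> shell_bounded r \<theta> M u \<Longrightarrow>
     (\<integral>\<^sup>+y. ennreal (wt (y::'a) powr (2 - N - \<theta>)) * epow (u y) p \<partial>lebesgue) \<le> ennreal (C3 * M powr p)"
    using weighted_mass_le[OF p \<theta>] by (auto simp: N_def)
  define C4 where "C4 = 10 * 4 powr \<bar>\<beta>\<bar>"
  define C5 where "C5 = C2 * C4 powr p"
  define C6 where "C6 = C1 * C3 * v powr recip r"
  define C where "C = 4 * (C5 + C6)"
  have Cpos: "0 < C5" "0 < C6" using C1 C2 C3 v by (auto simp: C5_def C6_def C4_def)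
  have "shell_bounded r \<theta> (C * M powr p) (\<lambda>x. \<integral>\<^sup>+y. fund_sol (x - y) * epow (u y) p \<partial>lborel)"
    if M: "0 \<le> M" and [measurable]: "u \<in> borel_measurable borel" and u: "shell_bounded r \<theta> M u" for M and u :: "'a \<Rightarrow> ennreal"
    unfolding shell_bounded_def
  proof (intro allI impI)
    fix R :: real assume R: "1 \<le> R"
    have ul: "u \<in> borel_measurable lebesgue" by (intro measurable_completion) simp
    let ?near = "\<lambda>x. \<integral>\<^sup>+y. fund_sol (x - y) * epow (u y) p * indicator {y. norm (x - y) < wt x / 2} y \<partial>lborel"
    let ?far = "\<lambda>x. \<integral>\<^sup>+y. fund_sol (x - y) * epow (u y) p * indicator {y. wt x / 2 \<le> norm (x - y)} y \<partial>lborel"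
    have split: "(\<integral>\<^sup>+y. fund_sol (x - y) * epow (u y) p \<partial>lborel) = ?near x + ?far x" for x
      by (subst nn_integral_add[symmetric]) (auto intro!: nn_integral_cong split: split_indicator)
    have "?far x \<le> ennreal (C1 * C3 * M powr p * R powr \<theta>)" if x: "x \<in> shell R" for x
    proof -
      have "wt x powr \<theta> \<le> R powr \<theta>"
        using x R \<theta>0 by (intro powr_mono2') (auto simp: shell_def)
      then have *: "ennreal (C1 * wt x powr \<theta> * wt y powr (2 - N - \<theta>))
          \<le> ennreal (C1 * R powr \<theta>) * ennreal (wt y powr (2 - N - \<theta>))" for y :: 'a
        using C1 by (simp add: mult_right_mono flip: ennreal_mult)
      have "?far x \<le> (\<integral>\<^sup>+y. ennreal (C1 * R powr \<theta>) * (ennreal (wt y powr (2 - N - \<theta>)) * epow (u y) p) \<partial>lborel)"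
        using order_trans[OF C1(2) *]
        by (intro nn_integral_mono) (auto split: split_indicator simp flip: mult.assoc intro!: mult_right_mono)
      also have "\<dots> = ennreal (C1 * R powr \<theta>) * (\<integral>\<^sup>+y. ennreal (wt y powr (2 - N - \<theta>)) * epow (u y) p \<partial>lebesgue)"
        by (simp add: nn_integral_cmult nn_integral_completion)
      also have "\<dots> \<le> ennreal (C1 * R powr \<theta>) * ennreal (C3 * M powr p)"
        by (intro mult_left_mono C3 M ul u) auto
      also have "\<dots> = ennreal (C1 * C3 * M powr p * R powr \<theta>)"
        using C1 C3 by (simp add: mult_ac flip: ennreal_mult)
      finally show ?thesis .
    qed
    \<comment> \<open>The far part is of size R^\<theta> pointwise on the shell; the volume of the
      shell supplies the remaining R^(N/r).\<close>
    then have "Lr_norm r (shell R) ?far \<le> ennreal (C1 * C3 * M powr p * R powr \<theta>) * ennreal ((v * R powr N) powr recip r)"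
      using emeasure_shell_le[of R, where 'a='a] R v
      by (intro Lr_norm_le_const r1 measurable_completion) (auto simp: v_def N_def powr_mult mult_ac)
    also have "\<dots> = ennreal (C6 * M powr p * R powr \<beta>)"
      using C1 C3 v R by (simp add: C6_def \<beta>_def powr_mult powr_powr powr_add mult_ac flip: ennreal_mult)
    finally have far: "Lr_norm r (shell R) ?far \<le> ennreal (C6 * M powr p * R powr \<beta>)" .
    have "Lr_norm r (shell R) ?near \<le> ennreal (C2 * R powr (2 - N * \<tau>)) * epow (Lr_norm r {x. R / 2 \<le> wt x \<and> wt x < 4 * R} u) p"
      by (intro C2 R) auto
    also have "\<dots> \<le> ennreal (C2 * R powr (2 - N * \<tau>)) * epow (ennreal (C4 * M * R powr \<beta>)) p"
      unfolding C4_def \<beta>_def N_def using p by (intro mult_left_mono epow_mono shell_bounded_fat r1 ul u M R) auto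
    also have "\<dots> = ennreal (C5 * M powr p * R powr (2 - N * \<tau> + p * \<beta>))"
      using C2 M by (simp add: C5_def C4_def powr_mult powr_powr powr_add mult_ac flip: ennreal_mult)
    also have "2 - N * \<tau> + p * \<beta> = \<beta> + (2 + (p - 1) * \<theta>)"
      by (simp add: \<beta>_def \<tau>_def algebra_simps)
    also have "ennreal (C5 * M powr p * R powr (\<beta> + (2 + (p - 1) * \<theta>))) \<le> ennreal (C5 * M powr p * R powr \<beta>)"
      using R \<theta> Cpos by (intro ennreal_leI mult_left_mono powr_mono) auto
    finally have near: "Lr_norm r (shell R) ?near \<le> ennreal (C5 * M powr p * R powr \<beta>)" .
    have "Lr_norm r (shell R) (\<lambda>x. \<integral>\<^sup>+y. fund_sol (x - y) * epow (u y) p \<partial>lborel)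
        \<le> 4 * (Lr_norm r (shell R) ?near + Lr_norm r (shell R) ?far)"
      unfolding split by (intro Lr_norm_add r1 measurable_completion) auto
    also have "\<dots> \<le> 4 * (ennreal (C5 * M powr p * R powr \<beta>) + ennreal (C6 * M powr p * R powr \<beta>))"
      by (intro mult_left_mono add_mono near far) auto
    also have "\<dots> = ennreal (C * M powr p * R powr \<beta>)"
    proof -
      have "C * M powr p * R powr \<beta> = 4 * (C5 * M powr p * R powr \<beta> + C6 * M powr p * R powr \<beta>)"
        by (simp add: C_def algebra_simps)
      then show ?thesis using Cpos by (simp only: ennreal_mult) (simp add: ennreal_mult)
    qed
    finally show "Lr_norm r (shell R) (\<lambda>x. \<integral>\<^sup>+y. fund_sol (x - y) * epow (u y) p \<partial>lborel)
       \<le> ennreal (C * M powr p * R powr (real DIM('a) * recip r + \<theta>))"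
      by (simp add: \<beta>_def N_def)
  qed
  moreover have "0 < C" using Cpos by (simp add: C_def)
  ultimately show ?thesis by blast
qed

section \<open>Stability of shell bounds under order, linear operations and monotone limits\<close>

lemma shell_bounded_mono:
  fixes u v :: "'a::euclidean_space \<Rightarrow> ennreal"
  assumes r: "1 < r" and "u \<in> borel_measurable lebesgue" "v \<in> borel_measurable lebesgue"
    and v: "shell_bounded r \<theta> M v" and uv: "AE x in lebesgue. u x \<le> v x" and M: "M \<le> M'"
  shows "shell_bounded r \<theta> M' u"
  unfolding shell_bounded_def
proof (intro allI impI)
  fix R :: real assume R: "1 \<le> R"
  have "Lr_norm r (shell R) u \<le> Lr_norm r (shell R) v"
    using uv by (intro Lr_norm_mono_AE assms) auto
  also have "\<dots> \<le> ennreal (M * R powr (real DIM('a) * recip r + \<theta>))"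
    by (rule shell_boundedD[OF v R])
  also have "\<dots> \<le> ennreal (M' * R powr (real DIM('a) * recip r + \<theta>))"
    using M by (intro ennreal_leI mult_right_mono) auto
  finally show "Lr_norm r (shell R) u \<le> ennreal (M' * R powr (real DIM('a) * recip r + \<theta>))" .
qed

lemma shell_bounded_add:
  fixes u v :: "'a::euclidean_space \<Rightarrow> ennreal"
  assumes r: "1 < r" and "u \<in> borel_measurable lebesgue" "v \<in> borel_measurable lebesgue"
    and u: "shell_bounded r \<theta> a u" and v: "shell_bounded r \<theta> b v" and ab: "0 \<le> a" "0 \<le> b"
  shows "shell_bounded r \<theta> (4 * (a + b)) (\<lambda>x. u x + v x)"
  unfolding shell_bounded_def
proof (intro allI impI)
  fix R :: real assume R: "1 \<le> R"
  let ?t = "R powr (real DIM('a) * recip r + \<theta>)"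
  have "Lr_norm r (shell R) (\<lambda>x. u x + v x) \<le> 4 * (Lr_norm r (shell R) u + Lr_norm r (shell R) v)"
    by (intro Lr_norm_add assms) auto
  also have "\<dots> \<le> 4 * (ennreal (a * ?t) + ennreal (b * ?t))"
    by (intro mult_left_mono add_mono shell_boundedD[OF u R] shell_boundedD[OF v R]) auto
  also have "\<dots> = ennreal (4 * (a * ?t + b * ?t))"
    using ab by (simp add: ennreal_mult distrib_left)
  also have "4 * (a * ?t + b * ?t) = 4 * (a + b) * ?t"
    by (simp add: distrib_left distrib_right)
  finally show "Lr_norm r (shell R) (\<lambda>x. u x + v x) \<le> ennreal (4 * (a + b) * ?t)" .
qed

lemma shell_bounded_cmult:
  fixes u :: "'a::euclidean_space \<Rightarrow> ennreal"
  assumes r: "1 < r" and "u \<in> borel_measurable lebesgue"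
    and u: "shell_bounded r \<theta> M u" and c: "0 \<le> c"
  shows "shell_bounded r \<theta> (c * M) (\<lambda>x. ennreal c * u x)"
  unfolding shell_bounded_def
proof (intro allI impI)
  fix R :: real assume R: "1 \<le> R"
  have "Lr_norm r (shell R) (\<lambda>x. ennreal c * u x) \<le> ennreal c * Lr_norm r (shell R) u"
    by (intro Lr_norm_cmult assms) auto
  also have "\<dots> \<le> ennreal c * ennreal (M * R powr (real DIM('a) * recip r + \<theta>))"
    by (intro mult_left_mono shell_boundedD[OF u R]) auto
  finally show "Lr_norm r (shell R) (\<lambda>x. ennreal c * u x) \<le> ennreal (c * M * R powr (real DIM('a) * recip r + \<theta>))"
    using c by (simp add: ennreal_mult' mult.assoc)
qed

lemma shell_bounded_SUP:
  fixes u :: "nat \<Rightarrow> 'a::euclidean_space \<Rightarrow> ennreal"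
  assumes "1 < r" "\<And>n. u n \<in> borel_measurable lebesgue" "\<And>x. incseq (\<lambda>n. u n x)"
    and "\<And>n. shell_bounded r \<theta> M (u n)"
  shows "shell_bounded r \<theta> M (\<lambda>x. SUP n. u n x)"
  unfolding shell_bounded_def using assms
  by (intro allI impI Lr_norm_SUP_le shell_boundedD) auto

text \<open>For the limit of the iterates this supplies the almost everywhere finiteness that turns
  it into a solution.\<close>

lemma shell_bounded_AE_finite:
  fixes u :: "'a::euclidean_space \<Rightarrow> ennreal"
  assumes "1 < r" "u \<in> borel_measurable lebesgue" "shell_bounded r \<theta> M u"
  shows "AE x in lebesgue. u x < \<infinity>"
proof -
  have "AE x in lebesgue. x \<in> shell (2 ^ j) \<longrightarrow> u x < \<infinity>" for j
  proof -
    have "Lr_norm r (shell (2 ^ j)) u \<le> ennreal (M * (2 ^ j) powr (real DIM('a) * recip r + \<theta>))"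
      using assms by (intro shell_boundedD) auto
    also have "\<dots> < top" by simp
    finally show ?thesis
      using Lr_norm_finite_imp_AE_finite[of r u "shell (2 ^ j)"] assms by simp
  qed
  then have "AE x in lebesgue. \<forall>j. x \<in> shell (2 ^ j) \<longrightarrow> u x < \<infinity>"
    by (subst AE_all_countable) simp
  then show ?thesis
    by (rule eventually_mono) (metis shell_cover)
qed

section \<open>Shell bounds versus local integrability and annular growth\<close>

lemma shell_bounded_imp_in_Lr_loc:
  fixes u :: "'a::euclidean_space \<Rightarrow> ennreal"
  assumes r: "1 < r" and u: "u \<in> borel_measurable lebesgue" "shell_bounded r \<theta> M u"
  shows "in_Lr_loc r u"
  unfolding in_Lr_loc_def
proof (intro conjI allI impI)
  fix K :: "'a set" assume K: "compact K"
  have fin: "Lr_norm r (\<Union>j<n. shell (2 ^ j)) u < top" for n :: nat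
  proof (induction n)
    case 0
    have "Lr_norm r {} u \<le> 0 * ennreal (1 powr recip r)"
      by (rule Lr_norm_le_const) (use r u in auto)
    then show ?case by simp
  next
    case (Suc n)
    have "Lr_norm r (shell (2 ^ n)) u \<le> ennreal (M * (2 ^ n) powr (real DIM('a) * recip r + \<theta>))"
      using u by (intro shell_boundedD) auto
    also have "\<dots> < top" by simp
    finally have "2 * (Lr_norm r (shell (2 ^ n)) u + Lr_norm r (\<Union>j<n. shell (2 ^ j)) u) < top"
      using Suc by (simp add: ennreal_mult_less_top)
    then show ?case
      using Lr_norm_Un[OF r u(1), of "shell (2 ^ n)" "\<Union>j<n. shell (2 ^ j)"]
      by (auto simp: lessThan_Suc intro: le_less_trans)
  qed
  obtain B where B: "\<And>x. x \<in> K \<Longrightarrow> norm x \<le> B"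
    using compact_imp_bounded[OF K] by (auto simp: bounded_iff)
  obtain n where n: "max 1 B < 2 ^ n"
    using real_arch_pow[of 2 "max 1 B"] by auto
  have "K \<subseteq> (\<Union>j<n. shell (2 ^ j))"
  proof
    fix x assume x: "x \<in> K"
    obtain j where j: "x \<in> shell (2 ^ j)" by (rule shell_cover)
    have "wt x \<le> max 1 B" using B[OF x] by (auto simp: wt_def)
    moreover have "2 ^ j \<le> wt x" using j by (simp add: shell_def)
    ultimately have "(2::real) ^ j < 2 ^ n" using n by linarith
    then have "j < n" by simp
    with j show "x \<in> (\<Union>j<n. shell (2 ^ j))" by auto
  qed
  then have "Lr_norm r K u \<le> Lr_norm r (\<Union>j<n. shell (2 ^ j)) u"
    using K by (intro Lr_norm_mono_AE r u) (auto simp: fmeasurableD[OF lmeasurable_compact])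
  with fin[of n] show "Lr_norm r K u < \<infinity>" by (auto intro: le_less_trans)
qed (rule u)

lemma shell_bounded_imp_annular_growth:
  fixes u :: "'a::euclidean_space \<Rightarrow> ennreal"
  assumes r: "1 < r" and u: "u \<in> borel_measurable lebesgue" "shell_bounded r \<theta> M u" and M: "0 \<le> M"
  shows "annular_growth r \<theta> u"
proof -
  define \<beta> where "\<beta> = real DIM('a) * recip r + \<theta>"
  have "ennreal (R powr (- (real DIM('a) * recip r) - \<theta>)) * Lr_norm r (annulus R) u \<le> ennreal (M * 2 powr (- \<beta>))"
    if R: "2 \<le> R" for R
  proof -
    \<comment> \<open>With \<open>R \<ge> 2\<close> the inner radius is at least 1, so
      \<open>wt\<close> is the norm on the annulus and the shell bound applies.\<close>
    have "annulus R \<subseteq> (shell (R / 2) :: 'a set)"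
      using R by (auto simp: annulus_def shell_def wt_def)
    then have "Lr_norm r (annulus R) u \<le> Lr_norm r (shell (R / 2)) u"
      by (intro Lr_norm_mono_AE r u) (auto simp: annulus_def)
    also have "\<dots> \<le> ennreal (M * (R / 2) powr \<beta>)"
      unfolding \<beta>_def using R by (intro shell_boundedD u) auto
    finally have "ennreal (R powr (- \<beta>)) * Lr_norm r (annulus R) u \<le> ennreal (R powr (- \<beta>)) * ennreal (M * (R / 2) powr \<beta>)"
      by (rule mult_left_mono) simp
    also have "\<dots> = ennreal (M * 2 powr (- \<beta>))"
      using R M by (simp add: powr_divide powr_minus field_simps flip: ennreal_mult)
    finally show ?thesis by (simp add: \<beta>_def)
  qed
  then have "\<forall>\<^sub>F R in at_top. ennreal (R powr (- (real DIM('a) * recip r) - \<theta>)) * Lr_norm r (annulus R) u \<le> ennreal (M * 2 powr (- \<beta>))"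
    by (auto simp: eventually_at_top_linorder)
  then have "Limsup at_top (\<lambda>R. ennreal (R powr (- (real DIM('a) * recip r) - \<theta>)) * Lr_norm r (annulus R) u) \<le> ennreal (M * 2 powr (- \<beta>))"
    by (rule Limsup_bounded)
  then show ?thesis
    unfolding annular_growth_def real_of_ereal_divide_eq_recip[OF r] by (auto intro: le_less_trans)
qed

text \<open>The limsup controls the shells beyond some radius \<open>R1\<close>; all others lie in
  one compact ball, where local integrability applies. Raising the exponent from \<theta> to
  \<theta>' only weakens the bound because \<open>R \<ge> 1\<close>.\<close>

lemma annular_growth_imp_shell_bounded:
  fixes f :: "'a::euclidean_space \<Rightarrow> ennreal"
  assumes r: "1 < r" and f: "in_Lr_loc r f" "annular_growth r \<theta> f" and \<theta>: "\<theta> \<le> \<theta>'"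
  shows "\<exists>M\<ge>0. shell_bounded r \<theta>' M f"
proof -
  define \<beta> where "\<beta> = real DIM('a) * recip r + \<theta>"
  define \<beta>' where "\<beta>' = real DIM('a) * recip r + \<theta>'"
  have \<beta>: "\<beta> \<le> \<beta>'" using \<theta> by (simp add: \<beta>_def \<beta>'_def)
  have fm: "f \<in> borel_measurable lebesgue" using f by (simp add: in_Lr_loc_def)
  let ?L = "\<lambda>R. ennreal (R powr (- \<beta>)) * Lr_norm r (annulus R) f"
  have "Limsup at_top ?L < \<infinity>"
    using f(2) unfolding annular_growth_def real_of_ereal_divide_eq_recip[OF r]
    by (simp add: \<beta>_def)
  then obtain b where "0 \<le> b" and b: "Limsup at_top ?L = ennreal b"
    by (cases "Limsup at_top ?L") auto
  define c where "c = b + 1"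
  have c: "0 < c" using \<open>0 \<le> b\<close> by (simp add: c_def)
  have "Limsup at_top ?L < ennreal c" using \<open>0 \<le> b\<close> by (simp add: b c_def ennreal_less_iff)
  then have "\<forall>\<^sub>F R in at_top. ?L R < ennreal c" by (rule Limsup_lessD)
  then obtain R0 where R0: "\<And>R. R0 \<le> R \<Longrightarrow> ?L R < ennreal c"
    by (auto simp: eventually_at_top_linorder)
  define R1 where "R1 = max 1 R0"
  have "Lr_norm r (cball 0 (2 * R1)) f < \<infinity>"
    using f(1) by (simp add: in_Lr_loc_def)
  then obtain d where d: "0 \<le> d" "Lr_norm r (cball 0 (2 * R1)) f = ennreal d"
    by (cases "Lr_norm r (cball 0 (2 * R1)) f") auto
  define M1 where "M1 = c * 2 powr \<beta>"
  \<comment> \<open>For a negative \<beta>' the target power of \<open>R\<close> is small on the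
    inner shells; the factor \<open>R1 powr \<bar>\<beta>'\<bar>\<close> compensates for this for
    all \<open>R \<le> R1\<close>.\<close>
  define M2 where "M2 = d * R1 powr \<bar>\<beta>'\<bar>"
  have M: "0 \<le> M1" "0 \<le> M2" using c d by (auto simp: M1_def M2_def)
  have "shell_bounded r \<theta>' (M1 + M2) f"
    unfolding shell_bounded_def
  proof (intro allI impI)
    fix R :: real assume R: "1 \<le> R"
    have Rp: "1 * R powr \<beta> \<le> R powr \<beta>'" using R \<beta> by (simp add: powr_mono)
    show "Lr_norm r (shell R) f \<le> ennreal ((M1 + M2) * R powr (real DIM('a) * recip r + \<theta>'))"
    proof (cases "R \<le> R1")
      case True
      have "shell R \<subseteq> cball (0::'a) (2 * R1)"
      proof
        fix x :: 'a assume "x \<in> shell R"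
        then show "x \<in> cball 0 (2 * R1)" using True norm_le_wt[of x] by (simp add: shell_def)
      qed
      then have "Lr_norm r (shell R) f \<le> ennreal d"
        unfolding d(2)[symmetric] by (intro Lr_norm_mono_AE r fm) auto
      also have "d \<le> d * (R1 powr \<bar>\<beta>'\<bar> * R powr \<beta>')"
      proof -
        have "1 \<le> R powr (\<bar>\<beta>'\<bar> + \<beta>')" using R by (intro ge_one_powr_ge_zero) auto
        also have "\<dots> = R powr \<bar>\<beta>'\<bar> * R powr \<beta>'" by (rule powr_add)
        also have "\<dots> \<le> R1 powr \<bar>\<beta>'\<bar> * R powr \<beta>'"
          using True R by (intro mult_right_mono powr_mono2) auto
        finally show ?thesis using d mult_left_mono[of 1 _ d] by simp
      qed
      also have "\<dots> \<le> (M1 + M2) * R powr \<beta>'"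
        using M by (simp add: M2_def[symmetric] distrib_right flip: mult.assoc)
      finally show ?thesis by (simp add: \<beta>'_def ennreal_leI)
    next
      case False
      then have R': "1 < R" "R0 \<le> 2 * R" using R by (auto simp: R1_def)
      have "shell R = (annulus (2 * R) :: 'a set)"
        using R' by (auto simp: annulus_def shell_def wt_def)
      then have "Lr_norm r (shell R) f = (ennreal ((2 * R) powr \<beta>) * ennreal ((2 * R) powr (- \<beta>))) * Lr_norm r (annulus (2 * R)) f"
        using R' by (simp add: powr_minus flip: ennreal_mult)
      also have "\<dots> = ennreal ((2 * R) powr \<beta>) * ?L (2 * R)"
        by (simp only: mult.assoc)
      also have "\<dots> \<le> ennreal ((2 * R) powr \<beta>) * ennreal c"
        using R0[OF R'(2)] by (intro mult_left_mono) auto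
      also have "\<dots> = ennreal (M1 * R powr \<beta>)"
        using R' c by (simp add: M1_def powr_mult mult_ac flip: ennreal_mult)
      also have "\<dots> \<le> ennreal ((M1 + M2) * R powr \<beta>')"
        using M Rp by (intro ennreal_leI mult_mono) auto
      finally show ?thesis by (simp add: \<beta>'_def)
    qed
  qed
  with M show ?thesis by (intro exI[of _ "M1 + M2"]) auto
qed

section \<open>Monotone iteration\<close>

definition solution_map ::
    "real \<Rightarrow> 'a::euclidean_space measure \<Rightarrow> real \<Rightarrow> ('a \<Rightarrow> ennreal) \<Rightarrow> 'a \<Rightarrow> ennreal" where
  "solution_map p \<mu> \<kappa> u x = (\<integral>\<^sup>+y. fund_sol (x - y) * epow (u y) p \<partial>lebesgue) + ennreal \<kappa> * potential \<mu> x"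

definition solution_iterate ::
    "real \<Rightarrow> 'a::euclidean_space measure \<Rightarrow> real \<Rightarrow> nat \<Rightarrow> 'a \<Rightarrow> ennreal" where
  "solution_iterate p \<mu> \<kappa> n = (solution_map p \<mu> \<kappa> ^^ n) (\<lambda>_. 0)"

lemma is_solution_iff:
  "is_solution p \<mu> \<kappa> u \<longleftrightarrow> u \<in> borel_measurable lebesgue \<and>
     (AE x in lebesgue. 0 < u x \<and> u x < \<infinity>) \<and> (AE x in lebesgue. u x = solution_map p \<mu> \<kappa> u x)"
  by (simp add: is_solution_def solution_map_def)

text \<open>Integration ignores null sets, so an inequality holding almost everywhere becomes one at
  every point. This allows pointwise increasing iterates to be compared with solutions that satisfy
  their equation only almost everywhere.\<close>

lemma solution_map_mono_AE:
  assumes "0 \<le> p" "AE x in lebesgue. u x \<le> v x" "\<kappa> \<le> \<kappa>'"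
  shows "solution_map p \<mu> \<kappa> u x \<le> solution_map p \<mu> \<kappa>' v x"
  unfolding solution_map_def using assms
  by (intro add_mono nn_integral_mono_AE mult_right_mono ennreal_leI)
     (auto elim!: eventually_mono intro!: mult_left_mono epow_mono)

section \<open>Measurability of potentials and iterates, and their monotonicity\<close>

lemma radon_measureD:
  assumes "radon_measure \<mu>"
  shows "sets \<mu> = sets borel" "space \<mu> = UNIV" "compact K \<Longrightarrow> emeasure \<mu> K < \<infinity>"
  using assms by (auto simp: radon_measure_def dest: sets_eq_imp_space_eq)

text \<open>Sigma-finiteness makes the parameter integral defining \<open>potential\<close>
  measurable in its parameter.\<close>

lemma radon_measure_sigma_finite:
  fixes \<mu> :: "'a::euclidean_space measure"
  assumes "radon_measure \<mu>"
  shows "sigma_finite_measure \<mu>"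
proof
  note s = radon_measureD[OF assms]
  have "\<exists>n. x \<in> cball (0::'a) (real n)" for x
    using real_arch_simple[of "norm x"] by auto
  then show "\<exists>A. countable A \<and> A \<subseteq> sets \<mu> \<and> \<Union> A = space \<mu> \<and> (\<forall>a\<in>A. emeasure \<mu> a \<noteq> \<infinity>)"
    by (intro exI[of _ "range (\<lambda>n. cball (0::'a) (real n))"])
      (auto simp: s(1,2) s(3)[OF compact_cball, THEN less_imp_neq, unfolded infinity_ennreal_def])
qed

lemma measurable_potential [measurable]:
  fixes \<mu> :: "'a::euclidean_space measure"
  assumes "radon_measure \<mu>"
  shows "potential \<mu> \<in> borel_measurable borel"
proof -
  interpret sigma_finite_measure \<mu> by (rule radon_measure_sigma_finite[OF assms])
  note [measurable_cong] = radon_measureD(1)[OF assms]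
  show ?thesis
    unfolding potential_def[abs_def] by measurable
qed

text \<open>Borel measurability is preserved, so all iterates stay Borel and the convolution
  estimates over \<open>lborel\<close> apply to them.\<close>

lemma measurable_solution_map:
  assumes "radon_measure \<mu>" "u \<in> borel_measurable borel"
  shows "solution_map p \<mu> \<kappa> u \<in> borel_measurable borel"
proof -
  note [measurable] = assms(2) measurable_potential[OF assms(1)]
  show ?thesis
    unfolding solution_map_def[abs_def] nn_integral_completion by measurable
qed

lemma measurable_solution_iterate:
  assumes "radon_measure \<mu>"
  shows "solution_iterate p \<mu> \<kappa> n \<in> borel_measurable borel"
  unfolding solution_iterate_def by (induction n) (auto intro: measurable_solution_map assms)

lemma solution_iterate_Suc:
  "solution_iterate p \<mu> \<kappa> (Suc n) = solution_map p \<mu> \<kappa> (solution_iterate p \<mu> \<kappa> n)"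
  by (simp add: solution_iterate_def)

lemma incseq_solution_iterate:
  assumes "0 \<le> p"
  shows "incseq (\<lambda>n. solution_iterate p \<mu> \<kappa> n x)"
proof -
  have "solution_iterate p \<mu> \<kappa> n x \<le> solution_iterate p \<mu> \<kappa> (Suc n) x" for n x
  proof (induction n arbitrary: x)
    case 0
    show ?case by (simp add: solution_iterate_def)
  next
    case (Suc n)
    show ?case
      unfolding solution_iterate_Suc[of _ _ _ "Suc n"] unfolding solution_iterate_Suc[of _ _ _ n]
      using Suc assms by (intro solution_map_mono_AE) (auto simp: solution_iterate_Suc[symmetric])
  qed
  then show ?thesis by (intro incseq_SucI)
qed

lemma solution_iterate_le:
  assumes p: "0 \<le> p" and v: "AE x in lebesgue. solution_map p \<mu> \<kappa> v x \<le> v x"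
  shows "AE x in lebesgue. solution_iterate p \<mu> \<kappa> n x \<le> v x"
proof (induction n)
  case 0
  show ?case by (simp add: solution_iterate_def)
next
  case (Suc n)
  have "solution_iterate p \<mu> \<kappa> (Suc n) x \<le> solution_map p \<mu> \<kappa> v x" for x
    unfolding solution_iterate_Suc using Suc p by (intro solution_map_mono_AE) auto
  with v show ?case by (auto elim!: eventually_mono intro: order_trans)
qed

lemma solution_map_SUP:
  fixes u :: "nat \<Rightarrow> 'a::euclidean_space \<Rightarrow> ennreal"
  assumes p: "0 < p" and [measurable]: "\<And>n. u n \<in> borel_measurable borel" and inc: "\<And>x. incseq (\<lambda>n. u n x)"
  shows "solution_map p \<mu> \<kappa> (\<lambda>x. SUP n. u n x) x = (SUP n. solution_map p \<mu> \<kappa> (u n) x)"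
proof -
  have "(\<integral>\<^sup>+y. fund_sol (x - y) * epow (SUP n. u n y) p \<partial>lebesgue)
      = (\<integral>\<^sup>+y. (SUP n. fund_sol (x - y) * epow (u n y) p) \<partial>lborel)"
    using p by (simp add: epow_SUP SUP_mult_left_ennreal nn_integral_completion)
  also have "\<dots> = (SUP n. \<integral>\<^sup>+y. fund_sol (x - y) * epow (u n y) p \<partial>lborel)"
    using inc p by (intro nn_integral_monotone_convergence_SUP)
      (auto simp: incseq_def le_fun_def intro!: mult_left_mono epow_mono)
  finally show ?thesis
    by (simp add: solution_map_def nn_integral_completion ennreal_SUP_add_left)
qed

section \<open>Lower bounds for the kernel and the potential\<close>

lemma fund_sol_bounded_below:
  assumes N: "DIM('a::euclidean_space) \<ge> 3" and D: "0 < D"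
  shows "\<exists>\<delta>>0. \<forall>z::'a. norm z \<le> D \<longrightarrow> ennreal \<delta> \<le> fund_sol z"
proof -
  obtain c where c: "0 < c" "\<And>x::'a. x \<noteq> 0 \<Longrightarrow> fund_sol x = ennreal (c * norm x powr (2 - real DIM('a)))"
    using fund_sol_eq_powr[OF N] by auto
  have "ennreal (c * D powr (2 - real DIM('a))) \<le> fund_sol z" if "norm z \<le> D" for z :: 'a
  proof (cases "z = 0")
    case False
    then have "D powr (2 - real DIM('a)) \<le> norm z powr (2 - real DIM('a))"
      using that N by (intro powr_mono2') auto
    then show ?thesis using c False by (simp add: ennreal_leI)
  qed (simp add: fund_sol_def)
  with c D show ?thesis by (intro exI[of _ "c * D powr (2 - real DIM('a))"]) auto
qed

text \<open>Some ball carries positive finite mass, and on bounded distances the kernel is bounded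
  below. This yields positivity of the limit everywhere and the initial lower bound in the
  nonexistence argument.\<close>

lemma potential_bounded_below:
  fixes \<mu> :: "'a::euclidean_space measure"
  assumes N: "DIM('a) \<ge> 3" and \<mu>: "radon_measure \<mu>" "emeasure \<mu> UNIV \<noteq> 0" and \<rho>: "0 \<le> \<rho>"
  shows "\<exists>\<delta>>0. \<forall>x::'a. norm x \<le> \<rho> \<longrightarrow> ennreal \<delta> \<le> potential \<mu> x"
proof -
  note s = radon_measureD(1)[OF \<mu>(1)]
  have "\<exists>n. emeasure \<mu> (cball 0 (real n)) \<noteq> 0"
  proof (rule ccontr)
    assume "\<nexists>n. emeasure \<mu> (cball 0 (real n)) \<noteq> 0"
    then have "(\<Union>n. cball (0::'a) (real n)) \<in> null_sets \<mu>"
      by (intro null_sets_UN) (auto simp: s)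
    moreover have "(\<Union>n. cball (0::'a) (real n)) = UNIV"
      using real_arch_simple by auto
    ultimately show False using \<mu> by auto
  qed
  then obtain n where n: "emeasure \<mu> (cball 0 (real n)) \<noteq> 0" by auto
  have "emeasure \<mu> (cball 0 (real n)) < \<infinity>" by (intro radon_measureD[OF \<mu>(1)] compact_cball)
  with n obtain m where m: "emeasure \<mu> (cball 0 (real n)) = ennreal m" "0 < m"
    by (cases "emeasure \<mu> (cball 0 (real n))") auto
  \<comment> \<open>The added 1 keeps the radius positive even when both \<rho> and \<open>n\<close>
    are 0.\<close>
  obtain \<epsilon> where \<epsilon>: "0 < \<epsilon>" "\<And>z::'a. norm z \<le> \<rho> + real n + 1 \<Longrightarrow> ennreal \<epsilon> \<le> fund_sol z"
    using fund_sol_bounded_below[OF N, of "\<rho> + real n + 1"] \<rho> by auto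
  have "ennreal (\<epsilon> * m) \<le> potential \<mu> x" if x: "norm x \<le> \<rho>" for x
  proof -
    have "ennreal (\<epsilon> * m) = (\<integral>\<^sup>+y. ennreal \<epsilon> * indicator (cball 0 (real n)) y \<partial>\<mu>)"
      using \<epsilon> m by (simp add: nn_integral_cmult_indicator s ennreal_mult)
    also have "\<dots> \<le> (\<integral>\<^sup>+y. fund_sol (x - y) \<partial>\<mu>)"
    proof (intro nn_integral_mono)
      fix y
      show "ennreal \<epsilon> * indicator (cball 0 (real n)) y \<le> fund_sol (x - y)"
        using x \<epsilon>(2)[of "x - y"] norm_triangle_ineq4[of x y] by (auto split: split_indicator)
    qed
    finally show ?thesis by (simp add: potential_def)
  qed
  with \<epsilon> m show ?thesis by (intro exI[of _ "\<epsilon> * m"]) auto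
qed

section \<open>Minimal solutions, and nonexistence for large parameters\<close>

lemma minimal_solution_exists:
  fixes \<mu> :: "'a::euclidean_space measure"
  assumes N: "DIM('a) \<ge> 3" and p: "0 < p" and \<mu>: "radon_measure \<mu>" "emeasure \<mu> UNIV \<noteq> 0" and \<kappa>: "0 < \<kappa>"
    and fin: "AE x in lebesgue. (SUP n. solution_iterate p \<mu> \<kappa> n x) < \<infinity>"
  shows "is_minimal_solution p \<mu> \<kappa> (\<lambda>x. SUP n. solution_iterate p \<mu> \<kappa> n x)"
proof -
  let ?u = "solution_iterate p \<mu> \<kappa>"
  let ?U = "\<lambda>x. SUP n. ?u n x"
  note [measurable] = measurable_solution_iterate[OF \<mu>(1)]
  have inc: "incseq (\<lambda>n. ?u n x)" for x using p by (intro incseq_solution_iterate) simp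
  \<comment> \<open>The limit satisfies the equation at every point, with values in [0,\<infinity>];
    finiteness, which is assumed, is the only requirement on a solution that could fail.\<close>
  have fix_eq: "?U x = solution_map p \<mu> \<kappa> ?U x" for x
  proof -
    have "?U x = (SUP n. ?u (Suc n) x)"
      by (intro antisym SUP_mono) (use incseq_SucD[OF inc] in auto)
    also have "\<dots> = solution_map p \<mu> \<kappa> ?U x"
      using p inc by (simp add: solution_iterate_Suc solution_map_SUP)
    finally show ?thesis .
  qed
  have pos: "0 < ?U x" for x
  proof -
    obtain \<delta> where "0 < \<delta>" "ennreal \<delta> \<le> potential \<mu> x"
      using potential_bounded_below[OF N \<mu>, of "norm x"] by auto
    then have "0 < potential \<mu> x" by (simp add: less_le_trans[of 0 "ennreal \<delta>"])
    then have "0 < ennreal \<kappa> * potential \<mu> x" using \<kappa> by (simp add: ennreal_zero_less_mult_iff)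
    also have "\<dots> \<le> solution_map p \<mu> \<kappa> ?U x" by (simp add: solution_map_def)
    finally show ?thesis unfolding fix_eq[symmetric] .
  qed
  have "?U \<in> borel_measurable lebesgue" by (intro measurable_completion) measurable
  moreover have "AE x in lebesgue. 0 < ?U x \<and> ?U x < \<infinity>"
    using fin by (rule eventually_mono) (intro conjI pos)
  moreover have "AE x in lebesgue. ?U x = solution_map p \<mu> \<kappa> ?U x"
    by (rule AE_I2) (rule fix_eq)
  ultimately have sol: "is_solution p \<mu> \<kappa> ?U"
    unfolding is_solution_iff by (intro conjI)
  have "AE x in lebesgue. ?U x \<le> v x" if v: "is_solution p \<mu> \<kappa> v" for v
  proof -
    have "AE x in lebesgue. v x = solution_map p \<mu> \<kappa> v x"
      using v unfolding is_solution_iff by blast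
    then have "AE x in lebesgue. solution_map p \<mu> \<kappa> v x \<le> v x"
      by eventually_elim simp
    then have "AE x in lebesgue. ?u n x \<le> v x" for n
      using p by (intro solution_iterate_le) auto
    then have "AE x in lebesgue. \<forall>n. ?u n x \<le> v x" by (subst AE_all_countable) simp
    then show ?thesis by (auto elim!: eventually_mono intro: SUP_least)
  qed
  with sol show ?thesis unfolding is_minimal_solution_def by blast
qed

text \<open>A solution for the larger parameter is a supersolution for the smaller one, so it caps
  all the iterates and is finite almost everywhere.\<close>

lemma minimal_solution_exists_below:
  fixes \<mu> :: "'a::euclidean_space measure"
  assumes N: "DIM('a) \<ge> 3" and p: "0 < p" and \<mu>: "radon_measure \<mu>" "emeasure \<mu> UNIV \<noteq> 0"
    and \<kappa>: "0 < \<kappa>" "\<kappa> \<le> \<kappa>'" and v: "is_solution p \<mu> \<kappa>' v"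
  shows "\<exists>u. is_minimal_solution p \<mu> \<kappa> u"
proof -
  have "solution_map p \<mu> \<kappa> v x \<le> solution_map p \<mu> \<kappa>' v x" for x
    using p \<kappa> by (intro solution_map_mono_AE) auto
  moreover have "AE x in lebesgue. v x = solution_map p \<mu> \<kappa>' v x"
    using v by (simp add: is_solution_iff)
  ultimately have "AE x in lebesgue. solution_map p \<mu> \<kappa> v x \<le> v x"
    by (auto elim!: eventually_mono)
  then have "AE x in lebesgue. solution_iterate p \<mu> \<kappa> n x \<le> v x" for n
    using p by (intro solution_iterate_le) auto
  then have "AE x in lebesgue. \<forall>n. solution_iterate p \<mu> \<kappa> n x \<le> v x" by (subst AE_all_countable) simp
  moreover have "AE x in lebesgue. v x < \<infinity>"
    using v by (auto simp: is_solution_iff elim!: eventually_mono)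
  ultimately have "AE x in lebesgue. (SUP n. solution_iterate p \<mu> \<kappa> n x) < \<infinity>"
    by eventually_elim (auto intro: le_less_trans SUP_least)
  then show ?thesis using minimal_solution_exists[OF N p \<mu> \<kappa>(1)] by blast
qed

lemma no_solution_for_large_parameter:
  fixes \<mu> :: "'a::euclidean_space measure"
  assumes N: "DIM('a) \<ge> 3" and p: "1 < p" and \<mu>: "radon_measure \<mu>" "emeasure \<mu> UNIV \<noteq> 0"
  shows "\<exists>K. \<forall>\<kappa> u. is_solution p \<mu> \<kappa> u \<longrightarrow> \<kappa> \<le> K"
proof -
  obtain \<delta> where \<delta>: "0 < \<delta>" "\<And>x. norm x \<le> 1 \<Longrightarrow> ennreal \<delta> \<le> potential \<mu> x"
    using potential_bounded_below[OF N \<mu>, of 1] by auto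
  obtain \<epsilon> where \<epsilon>: "0 < \<epsilon>" "\<And>z::'a. norm z \<le> 2 \<Longrightarrow> ennreal \<epsilon> \<le> fund_sol z"
    using fund_sol_bounded_below[OF N, of 2] by auto
  define B where "B = ball (0::'a) 1"
  define b where "b = unit_ball_vol (real DIM('a))"
  have b: "0 < b" "emeasure lebesgue B = ennreal b" by (simp_all add: b_def B_def emeasure_ball)
  define c0 where "c0 = \<epsilon> * b"
  have c0: "0 < c0" using \<epsilon> b by (simp add: c0_def)
  \<comment> \<open>On the unit ball a lower bound \<open>t\<close> improves to
    \<open>c0 * t powr p\<close>. The potential starts this recursion at \<kappa>\<delta>, and
    \<kappa> > \<open>K\<close> says that the start exceeds the fixed point of the
    recursion.\<close>
  define K where "K = (1 / c0) powr (1 / (p - 1)) / \<delta>"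
  have K: "0 < K" using c0 \<delta> by (simp add: K_def)
  have "\<kappa> \<le> K" if u: "is_solution p \<mu> \<kappa> u" for \<kappa> and u :: "'a \<Rightarrow> ennreal"
  proof (rule ccontr)
    assume "\<not> \<kappa> \<le> K"
    then have \<kappa>: "K < \<kappa>" by simp
    define m where "m = \<kappa> * \<delta>"
    have m: "0 < m" using \<kappa> K \<delta>(1) by (simp add: m_def)
    \<comment> \<open>For t \<ge> m the gain \<open>c0 * t powr p\<close> is at least
      \<open>l * t\<close>, so the superlinear recursion may be replaced by geometric growth with
      ratio \<open>l > 1\<close>.\<close>
    define l where "l = c0 * m powr (p - 1)"
    have "(1 / c0) powr (1 / (p - 1)) < m"
      using \<kappa> \<delta>(1) unfolding K_def m_def by (simp only: pos_divide_less_eq)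
    then have "((1 / c0) powr (1 / (p - 1))) powr (p - 1) < m powr (p - 1)"
      using p by (intro powr_less_mono2) auto
    then have "1 / c0 < m powr (p - 1)" using p c0 by (simp add: powr_powr)
    then have "1 < m powr (p - 1) * c0" using c0 by (simp only: pos_divide_less_eq)
    then have l: "1 < l" by (simp only: l_def mult.commute)
    have eq: "AE x in lebesgue. u x = solution_map p \<mu> \<kappa> u x"
      using u unfolding is_solution_iff by blast
    have bound: "AE x in lebesgue. x \<in> B \<longrightarrow> ennreal (l ^ n * m) \<le> u x" for n
    proof (induction n)
      case 0
      have *: "ennreal m \<le> solution_map p \<mu> \<kappa> u x" if "x \<in> B" for x
      proof -
        have "ennreal m = ennreal \<kappa> * ennreal \<delta>"
          using \<kappa> K \<delta>(1) by (simp add: m_def ennreal_mult)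
        also have "\<dots> \<le> ennreal \<kappa> * potential \<mu> x"
          using that by (intro mult_left_mono \<delta>) (auto simp: B_def)
        also have "\<dots> \<le> solution_map p \<mu> \<kappa> u x" by (simp add: solution_map_def)
        finally show ?thesis .
      qed
      from eq show ?case by eventually_elim (simp add: *)
    next
      case (Suc n)
      define t where "t = l ^ n * m"
      have t: "m \<le> t" "0 < t" using l m by (auto simp: t_def)
      have *: "ennreal (l ^ Suc n * m) \<le> solution_map p \<mu> \<kappa> u x" if x: "x \<in> B" for x
      proof -
        have "l * t = c0 * (m powr (p - 1) * t)" by (simp add: l_def)
        also have "\<dots> \<le> c0 * (t powr (p - 1) * t)"
          using t m p c0 by (intro mult_left_mono mult_right_mono powr_mono2) auto
        also have "t powr (p - 1) * t = t powr p"
          using t powr_add[of t "p - 1" 1] by simp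
        finally have "ennreal (l ^ Suc n * m) \<le> ennreal (c0 * t powr p)"
          by (intro ennreal_leI) (simp add: t_def)
        also have "\<dots> = ennreal (\<epsilon> * t powr p) * emeasure lebesgue B"
          using \<epsilon>(1) b by (simp add: c0_def mult_ac flip: ennreal_mult)
        also have "\<dots> = (\<integral>\<^sup>+y. ennreal (\<epsilon> * t powr p) * indicator B y \<partial>lebesgue)"
          by (rule nn_integral_cmult_indicator[symmetric]) (simp add: B_def)
        also have "\<dots> \<le> (\<integral>\<^sup>+y. fund_sol (x - y) * epow (u y) p \<partial>lebesgue)"
        proof (intro nn_integral_mono_AE)
          show "AE y in lebesgue. ennreal (\<epsilon> * t powr p) * indicator B y \<le> fund_sol (x - y) * epow (u y) p"
            using Suc
          proof eventually_elim
            fix y assume y: "y \<in> B \<longrightarrow> ennreal (l ^ n * m) \<le> u y"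
            show "ennreal (\<epsilon> * t powr p) * indicator B y \<le> fund_sol (x - y) * epow (u y) p"
            proof (cases "y \<in> B")
              case True
              then have "norm (x - y) \<le> 2"
                using x norm_triangle_ineq4[of x y] by (auto simp: B_def)
              moreover have "epow (ennreal t) p \<le> epow (u y) p"
                using y True p by (intro epow_mono) (auto simp: t_def)
              ultimately have "ennreal \<epsilon> * ennreal (t powr p) \<le> fund_sol (x - y) * epow (u y) p"
                using \<epsilon> t by (intro mult_mono) auto
              then show ?thesis using True \<epsilon> by (simp add: ennreal_mult)
            qed simp
          qed
        qed
        also have "\<dots> \<le> solution_map p \<mu> \<kappa> u x" by (simp add: solution_map_def)
        finally show ?thesis .
      qed
      from eq show ?case by eventually_elim (use * in auto)
    qed
    then have "AE x in lebesgue. \<forall>n. x \<in> B \<longrightarrow> ennreal (l ^ n * m) \<le> u x"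
      by (subst AE_all_countable) simp
    moreover have "AE x in lebesgue. u x < \<infinity>"
      using u by (auto simp: is_solution_iff elim!: eventually_mono)
    ultimately have "AE x in lebesgue. x \<notin> B"
    proof eventually_elim
      fix x assume x: "\<forall>n. x \<in> B \<longrightarrow> ennreal (l ^ n * m) \<le> u x" "u x < \<infinity>"
      show "x \<notin> B"
      proof
        assume "x \<in> B"
        obtain w where w: "0 \<le> w" "u x = ennreal w" using x(2) by (cases "u x") auto
        obtain n where "w / m < l ^ n" using real_arch_pow[OF l] by auto
        then have "w < l ^ n * m" using m by (simp add: pos_divide_less_eq)
        moreover have "ennreal (l ^ n * m) \<le> ennreal w" using x(1) \<open>x \<in> B\<close> w by simp
        ultimately show False using w m l by (simp add: ennreal_le_iff)
      qed
    qed
    then have "emeasure lebesgue B = 0"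
      by (subst (asm) AE_iff_measurable[where N=B]) (auto simp: B_def)
    with b show False by simp
  qed
  then show ?thesis by (intro exI[of _ K] allI impI)
qed

section \<open>Existence for small parameters\<close>

lemma shell_bounded_iterates:
  fixes \<mu> :: "'a::euclidean_space measure"
  assumes N: "DIM('a) \<ge> 3" and p: "1 < p" "ereal p < r"
    and r: "(p - 1) * recip r < 2 / real DIM('a)"
    and \<theta>: "2 - real DIM('a) \<le> \<theta>" "2 + (p - 1) * \<theta> < 0"
    and \<mu>: "radon_measure \<mu>" and F: "0 \<le> F" "shell_bounded r \<theta> F (potential \<mu>)"
  shows "\<exists>\<kappa>0>0. \<forall>\<kappa>. 0 < \<kappa> \<longrightarrow> \<kappa> \<le> \<kappa>0 \<longrightarrow> (\<exists>M\<ge>0. \<forall>n. shell_bounded r \<theta> M (solution_iterate p \<mu> \<kappa> n))"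
proof -
  have r1: "1 < r" using p by (rule one_less_exponent)
  obtain C where C: "0 < C" "\<And>M u. 0 \<le> M \<Longrightarrow> u \<in> borel_measurable borel \<Longrightarrow> shell_bounded r \<theta> M u \<Longrightarrow>
     shell_bounded r \<theta> (C * M powr p) (\<lambda>x::'a. \<integral>\<^sup>+y. fund_sol (x - y) * epow (u y) p \<partial>lborel)"
    using shell_bounded_fund_sol_conv[where 'a='a, OF N p r \<theta>] by auto
  text \<open>\<open>M\<close> is chosen with \<open>8 C M\<^sup>p = M\<close>.\<close>
  define M where "M = (1 / (8 * C)) powr (1 / (p - 1))"
  have M: "0 < M" using C by (simp add: M_def)
  have "M powr p = M * M powr (p - 1)" using M powr_add[of M 1 "p - 1"] by simp
  also have "M powr (p - 1) = 1 / (8 * C)" using p C by (simp add: M_def powr_powr)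
  finally have CM: "C * M powr p = M / 8" using C by simp
  \<comment> \<open>This gives \<open>\<kappa> * F \<le> M / 8\<close>, the \<open>+ 1\<close>
    covering \<open>F = 0\<close>. The nonlinear term also contributes \<open>M / 8\<close>, and the
    factor 4 from adding shell bounds brings the total back to exactly \<open>M\<close>.\<close>
  define \<kappa>0 where "\<kappa>0 = M / (8 * (F + 1))"
  have "\<forall>n. shell_bounded r \<theta> M (solution_iterate p \<mu> \<kappa> n)" if \<kappa>: "0 < \<kappa>" "\<kappa> \<le> \<kappa>0" for \<kappa>
  proof
    fix n
    have "\<kappa> * F \<le> \<kappa>0 * (F + 1)" using \<kappa> F by (intro mult_mono) auto
    also have "\<dots> = M / 8" using F by (simp add: \<kappa>0_def del: distrib_left_numeral)
    finally have \<kappa>F: "\<kappa> * F \<le> M / 8" .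
    show "shell_bounded r \<theta> M (solution_iterate p \<mu> \<kappa> n)"
    proof (induction n)
      case 0
      have "Lr_norm r (shell R) (\<lambda>_::'a. 0) \<le> 0 * Lr_norm r (shell R) (\<lambda>_::'a. 0)" for R
        using Lr_norm_cmult[of r "\<lambda>_::'a. 0" "shell R" 0] r1 by simp
      then show ?case by (simp add: solution_iterate_def shell_bounded_def)
    next
      case (Suc n)
      let ?u = "solution_iterate p \<mu> \<kappa> n"
      let ?V = "\<lambda>x::'a. \<integral>\<^sup>+y. fund_sol (x - y) * epow (?u y) p \<partial>lborel"
      note [measurable] = measurable_solution_iterate[OF \<mu>] measurable_potential[OF \<mu>]
      have V: "shell_bounded r \<theta> (M / 8) ?V"
        unfolding CM[symmetric] using M Suc by (intro C) auto
      have meas: "?V \<in> borel_measurable lebesgue" "potential \<mu> \<in> borel_measurable lebesgue"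
        "(\<lambda>x. ennreal \<kappa> * potential \<mu> x) \<in> borel_measurable lebesgue"
        by (intro measurable_completion; measurable)+
      have "shell_bounded r \<theta> (\<kappa> * F) (\<lambda>x. ennreal \<kappa> * potential \<mu> x)"
        using \<kappa> F by (intro shell_bounded_cmult r1 meas) auto
      then have "shell_bounded r \<theta> (4 * (M / 8 + \<kappa> * F)) (\<lambda>x. ?V x + ennreal \<kappa> * potential \<mu> x)"
        using M \<kappa> F by (intro shell_bounded_add r1 V meas) auto
      moreover have "solution_iterate p \<mu> \<kappa> (Suc n) = (\<lambda>x. ?V x + ennreal \<kappa> * potential \<mu> x)"
        by (simp add: solution_iterate_Suc solution_map_def[abs_def] nn_integral_completion)
      moreover have "(\<lambda>x. ?V x + ennreal \<kappa> * potential \<mu> x) \<in> borel_measurable lebesgue"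
        using meas by measurable
      ultimately show ?case
        using shell_bounded_mono[OF r1, of "\<lambda>x. ?V x + ennreal \<kappa> * potential \<mu> x" _ \<theta> _ M] \<kappa>F by simp
    qed
  qed
  moreover have "0 < \<kappa>0" using M F by (simp add: \<kappa>0_def)
  ultimately show ?thesis
    using M by (intro exI[of _ \<kappa>0] conjI allI impI exI[of _ M]) auto
qed

section \<open>The threshold parameter and the growth of minimal solutions\<close>

theorem corollary1p1:
  fixes \<mu> :: "'a::euclidean_space measure"
    and p \<theta> :: real and r :: ereal
  assumes "DIM('a) \<ge> 3"
    and "1 < p" and "ereal p < r"
    and "p > real DIM('a) / (real DIM('a) - 2)"
    and "r > ereal (real DIM('a) * (p - 1) / 2)"
    and "radon_measure \<mu>" and "emeasure \<mu> UNIV \<noteq> 0"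
    and "in_Lr_loc r (potential \<mu>)"
    and "\<theta> < - 2 / (p - 1)"
    and "annular_growth r \<theta> (potential \<mu>)"
  shows "\<exists>\<kappa>s>0::real.
     (\<forall>\<kappa>. 0 < \<kappa> \<and> \<kappa> < \<kappa>s \<longrightarrow> (\<exists>u. is_minimal_solution p \<mu> \<kappa> u)) \<and>
     (\<forall>\<kappa>>\<kappa>s. \<not> (\<exists>u. is_solution p \<mu> \<kappa> u)) \<and>
     (\<exists>\<kappa>l. 0 < \<kappa>l \<and> \<kappa>l \<le> \<kappa>s \<and>
        (\<forall>\<kappa>. 0 < \<kappa> \<and> \<kappa> < \<kappa>l \<longrightarrow>
           (\<forall>u. is_minimal_solution p \<mu> \<kappa> u \<longrightarrow>
              in_Lr_loc r u \<and> annular_growth r (max \<theta> (2 - real DIM('a))) u)))"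
proof -
  note N = assms(1) and p = assms(2,3) and \<mu> = assms(6,7)
  have p0: "0 < p" using p by simp
  have r1: "1 < r" using p by (rule one_less_exponent)
  have N3: "3 \<le> real DIM('a)" using N by linarith
  define \<theta>s where "\<theta>s = max \<theta> (2 - real DIM('a))"
  have "\<theta>s < - 2 / (p - 1)"
  proof -
    have "real DIM('a) < p * (real DIM('a) - 2)"
      using assms(4) N3 by (simp add: pos_divide_less_eq)
    then have "(2 - real DIM('a)) * (p - 1) < - 2" by (simp add: algebra_simps)
    then have "2 - real DIM('a) < - 2 / (p - 1)" using p by (simp only: pos_less_divide_eq)
    with assms(9) show ?thesis by (simp add: \<theta>s_def)
  qed
  then have "\<theta>s * (p - 1) < - 2" using p by (simp only: pos_less_divide_eq)
  then have \<theta>s: "2 - real DIM('a) \<le> \<theta>s" "2 + (p - 1) * \<theta>s < 0"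
    by (auto simp: \<theta>s_def mult.commute)
  \<comment> \<open>This is the lower bound on \<open>r\<close> written through 1/r, the form in
    which it also makes sense for \<open>r = \<infinity>\<close>, where the left side is 0.\<close>
  have r: "(p - 1) * recip r < 2 / real DIM('a)"
    using r1
  proof (cases rule: exponent_cases)
    case (finite s)
    then show ?thesis using assms(5) N3 by (simp add: field_simps)
  qed (use N3 in simp)
  obtain F where F: "0 \<le> F" "shell_bounded r \<theta>s F (potential \<mu>)"
    using annular_growth_imp_shell_bounded[OF r1 assms(8) assms(10), of \<theta>s] by (auto simp: \<theta>s_def)
  obtain \<kappa>0 where \<kappa>0: "0 < \<kappa>0" and iter: "\<And>\<kappa>. 0 < \<kappa> \<Longrightarrow> \<kappa> \<le> \<kappa>0 \<Longrightarrow>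
      \<exists>M\<ge>0. \<forall>n. shell_bounded r \<theta>s M (solution_iterate p \<mu> \<kappa> n)"
    using shell_bounded_iterates[OF N p r \<theta>s \<mu>(1) F] by blast
  have sol: "\<exists>u M. is_minimal_solution p \<mu> \<kappa> u \<and> 0 \<le> M \<and> shell_bounded r \<theta>s M u" if \<kappa>: "0 < \<kappa>" "\<kappa> \<le> \<kappa>0" for \<kappa>
  proof -
    obtain M where M: "0 \<le> M" "\<And>n. shell_bounded r \<theta>s M (solution_iterate p \<mu> \<kappa> n)"
      using iter[OF \<kappa>] by blast
    let ?U = "\<lambda>x. SUP n. solution_iterate p \<mu> \<kappa> n x"
    note [measurable] = measurable_solution_iterate[OF \<mu>(1)]
    have U: "shell_bounded r \<theta>s M ?U"
      using p0 by (intro shell_bounded_SUP r1 M incseq_solution_iterate measurable_completion) auto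
    moreover have "AE x in lebesgue. ?U x < \<infinity>"
      by (rule shell_bounded_AE_finite[OF r1 _ U]) (intro measurable_completion, measurable)
    then have "is_minimal_solution p \<mu> \<kappa> ?U"
      by (intro minimal_solution_exists N p0 \<mu> \<kappa>)
    ultimately show ?thesis using M by blast
  qed
  \<comment> \<open>With every parameter \<open>K\<close> contains all smaller positive ones, so its
    supremum separates existence from nonexistence; the supremum itself is left undecided.\<close>
  define K where "K = {\<kappa>. 0 < \<kappa> \<and> (\<exists>u. is_solution p \<mu> \<kappa> u)}"
  have "\<kappa>0 \<in> K"
    using sol[OF \<kappa>0 order_refl] \<kappa>0 by (auto simp: K_def is_minimal_solution_def)
  have "bdd_above K"
    using no_solution_for_large_parameter[OF N p(1) \<mu>] by (auto simp: K_def bdd_above_def)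
  define \<kappa>s where "\<kappa>s = Sup K"
  have \<kappa>0s: "\<kappa>0 \<le> \<kappa>s"
    unfolding \<kappa>s_def by (rule cSup_upper) fact+
  show ?thesis
  proof (rule exI[of _ \<kappa>s], intro conjI allI impI)
    show "0 < \<kappa>s" using \<kappa>0 \<kappa>0s by simp
    fix \<kappa> assume \<kappa>: "0 < \<kappa> \<and> \<kappa> < \<kappa>s"
    then obtain \<kappa>' where "\<kappa>' \<in> K" "\<kappa> < \<kappa>'"
      using \<open>\<kappa>0 \<in> K\<close> \<open>bdd_above K\<close> unfolding \<kappa>s_def by (subst (asm) less_cSup_iff) auto
    then obtain v where "is_solution p \<mu> \<kappa>' v" by (auto simp: K_def)
    then show "\<exists>u. is_minimal_solution p \<mu> \<kappa> u"
      using \<kappa> \<open>\<kappa> < \<kappa>'\<close> by (intro minimal_solution_exists_below[OF N p0 \<mu>]) auto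
  next
    fix \<kappa> assume "\<kappa>s < \<kappa>"
    show "\<not> (\<exists>u. is_solution p \<mu> \<kappa> u)"
    proof
      assume "\<exists>u. is_solution p \<mu> \<kappa> u"
      then have "\<kappa> \<in> K" using \<open>\<kappa>s < \<kappa>\<close> \<kappa>0 \<kappa>0s by (simp add: K_def)
      then have "\<kappa> \<le> \<kappa>s" unfolding \<kappa>s_def using \<open>bdd_above K\<close> by (rule cSup_upper)
      with \<open>\<kappa>s < \<kappa>\<close> show False by simp
    qed
  next
    show "\<exists>\<kappa>l. 0 < \<kappa>l \<and> \<kappa>l \<le> \<kappa>s \<and>
        (\<forall>\<kappa>. 0 < \<kappa> \<and> \<kappa> < \<kappa>l \<longrightarrow>
           (\<forall>u. is_minimal_solution p \<mu> \<kappa> u \<longrightarrow>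
              in_Lr_loc r u \<and> annular_growth r (max \<theta> (2 - real DIM('a))) u))"
    proof (rule exI[of _ \<kappa>0], intro conjI \<kappa>0 \<kappa>0s allI impI)
      fix \<kappa> and u :: "'a \<Rightarrow> ennreal"
      assume \<kappa>: "0 < \<kappa> \<and> \<kappa> < \<kappa>0" and u: "is_minimal_solution p \<mu> \<kappa> u"
      \<comment> \<open>Minimality of \<open>u\<close> is tested against the solution
        \<open>v\<close> built by iteration, which transfers the shell bound of \<open>v\<close> to
        \<open>u\<close>.\<close>
      obtain v M where v: "is_minimal_solution p \<mu> \<kappa> v" "0 \<le> M" "shell_bounded r \<theta>s M v"
        using sol[of \<kappa>] \<kappa> by auto
      have meas: "u \<in> borel_measurable lebesgue" "v \<in> borel_measurable lebesgue"
        using u v(1) by (simp_all add: is_minimal_solution_def is_solution_def)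
      have "AE x in lebesgue. u x \<le> v x"
        using u v(1) unfolding is_minimal_solution_def by blast
      then have "shell_bounded r \<theta>s M u"
        using shell_bounded_mono[OF r1 meas v(3)] by simp
      then show "in_Lr_loc r u" "annular_growth r (max \<theta> (2 - real DIM('a))) u"
        using shell_bounded_imp_in_Lr_loc[OF r1 meas(1)]
          shell_bounded_imp_annular_growth[OF r1 meas(1) _ v(2)] by (simp_all add: \<theta>s_def)
    qed
  qed
qed

end
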